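(* Let $\sigma_1,\sigma_2,\ldots\in\overline{K}_c$ satisfy $|\sigma_1|=1$ and $|\sigma_l|\le1$ for $l\ge2$, let $\delta_0=\sum_{l\ge1}\sigma_l\Delta^{(l)}$ and $\delta=\tau^{-1}\delta_0$, suppose $\delta$ is a delta operator with basic sequence $\{P_n\}_{n\ge0}$, and let $Q_n=P_n/D_n$. Then $\{Q_n\}_{n\ge0}$ is an orthonormal basis of $C_0(O,\overline{K}_c)$: every $f\in C_0(O,\overline{K}_c)$ has a uniformly convergent expansion $$f(t)=\sum_{n=0}^\infty\psi_nQ_n(t),\qquad t\in O,$$ where $\psi_n=(\delta_0^{(n)}f)(1)$, $|\psi_n|\to0$ as $n\to\infty$, and $\|f\|=\sup_{n\ge0}|\psi_n|$.
   Context: Let $p$ be a prime, $q=p^\nu$, $K=\mathbb F_q((x))$ the field of formal Laurent series over $\mathbb F_q$ with absolute value $|\sum_{i\ge m}\zeta_ix^i|=q^{-m}$ ($\zeta_m\ne0$), $O=\{z\in K:|z|\le1\}$, and $\overline{K}_c$ the completion of an algebraic closure of $K$. $C_0(O,\overline{K}_c)$ is the Banach space of continuous $\mathbb F_q$-linear functions $f:O\to\overline{K}_c$ ($f(t_1+t_2)=f(t_1)+f(t_2)$, $f(\alpha t)=\alpha f(t)$ for $\alpha\in\mathbb F_q$) with the sup norm $\|f\|=\sup_{t\in O}|f(t)|$. $\overline{K}_c\{t\}$ is the $\overline{K}_c$-vector space of $\mathbb F_q$-linear polynomials $\sum_k a_kt^{q^k}$ (finite sums). For $\lambda\in K$, $(\rho_\lambda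 u)(t)=u(\lambda t)$; an operator is invariant if it commutes with all $\rho_\lambda$. $\tau u=u^q$ (Frobenius), and on polynomials with no linear term $\tau^{-1}\sum_{k\ge1}a_kt^{q^k}=\sum_{k\ge1}a_k^{1/q}t^{q^{k-1}}$. $[i]=x^{q^i}-x$; $D_0=1$, $D_i=[i][i-1]^q\cdots[1]^{q^{i-1}}$. $\Delta$ is the operator $(\Delta u)(t)=u(xt)-xu(t)$, $d=\tau^{-1}\Delta$ (the Carlitz derivative), and $\Delta^{(l)}=\tau^ld^l$ ($\Delta^{(0)}=\mathrm{id}$); explicitly $\Delta^{(l)}(t^{q^n})=\frac{D_n}{D_{n-l}^{q^l}}t^{q^n}$ for $n\ge l$ and $0$ for $n<l$. The series $\sum_{l\ge1}\sigma_l\Delta^{(l)}$ is a finite sum on each element of $\overline{K}_c\{t\}$. A delta operator is $\delta=\tau^{-1}\delta_0$ with $\delta_0$ linear invariant, $\delta_0(t)=0$ and $\delta_0(t^{q^n})=c_nt^{q^n}$, $c_n\ne0$ for $n\ge1$. Its basic sequence is the unique $\{P_n\}$ in $\overline{K}_c\{t\}$ with $\deg P_n=q^n$, $P_0(1)=1$, $P_n(1)=0$ ($n\ge1$), $\delta P_0=0$, $\delta P_n=[n]^{1/q}P_{n-1}$ ($n\ge1$). For $n\ge0$, $\delta_0^{(n)}=\tau^n\delta^n$. For an $\mathbb F_q$-linear polynomial $f$, $(\delta_0^{(n)}f)(1)$ is defined directly; for general $f\in C_0(O,\overline{K}_c)$, $(\delta_0^{(n)}f)(1)$ denotes the value at $f$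 of the continuous extension of the linear functional $F\mapsto(\delta_0^{(n)}F)(1)$ from $\mathbb F_q$-linear polynomials (which are dense in $C_0(O,\overline{K}_c)$), i.e. $\lim_N(\delta_0^{(n)}F_N)(1)$ for any sequence of such polynomials $F_N\to f$ uniformly on $O$. *)

theory Defs
  imports "HOL-Analysis.Analysis" "HOL-Algebra.Algebraic_Closure_Type"
begin

(* HOL-Algebra reuses the names degree, coeff, monom and smult, hence the qualified Polynomial.* below. *)

section \<open>The local field and its completed algebraic closure\<close>

text \<open>
  A finite field of cardinality \<open>q\<close> is a type \<open>'k\<close> of class \<open>{field, finite}\<close>;
  \<open>K\<close> is the type \<open>'k fls\<close>.  The library metric on \<open>'k fls\<close> uses the base \<open>2\<close> instead of \<open>q\<close>;
  it induces the same topology as \<open>fls_abs\<close> and is used for continuity only.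
\<close>

definition fls_abs :: "'k::{field,finite} fls \<Rightarrow> real" where
  "fls_abs z = (if z = 0 then 0 else real CARD('k) powi (- fls_subdegree z))"

definition int_ring :: "'k::{field,finite} fls set" where
  "int_ring = {z. fls_abs z \<le> 1}"

definition vabs :: "'c::{field,metric_space} \<Rightarrow> real" where
  "vabs z = dist z 0"

text \<open>
  \<open>\<iota>\<close> exhibits \<open>'c\<close> as the completion of an algebraic closure of \<open>K\<close>: \<open>'c\<close> is a complete field for
  (the metric of) a non-archimedean absolute value, \<open>\<iota>\<close> extends to a field embedding \<open>j\<close> of the
  algebraic closure with dense image, and the absolute value extends the one of \<open>K\<close>.
  These properties determine \<open>'c\<close> up to isometric isomorphism over \<open>K\<close>.
\<close>

definition completed_alg_closure ::
    "('k::{field,finite} fls \<Rightarrow> 'c::{field,complete_space}) \<Rightarrow> bool" where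
  "completed_alg_closure \<iota> \<longleftrightarrow>
     (\<forall>u v :: 'c. dist u v = vabs (u - v)) \<and>
     (\<forall>u v :: 'c. vabs (u * v) = vabs u * vabs v) \<and>
     (\<forall>u v :: 'c. vabs (u + v) \<le> max (vabs u) (vabs v)) \<and>
     (\<forall>z. vabs (\<iota> z) = fls_abs z) \<and>
     (\<exists>j :: 'k fls alg_closure \<Rightarrow> 'c.
        j 1 = 1 \<and> (\<forall>a b. j (a + b) = j a + j b) \<and> (\<forall>a b. j (a * b) = j a * j b) \<and>
        (\<forall>z. j (to_ac z) = \<iota> z) \<and> closure (range j) = UNIV)"

section \<open>Continuous linear functions on the ring of integers\<close>

definition C0 :: "('k::{field,finite} fls \<Rightarrow> 'c::{field,metric_space}) \<Rightarrow> ('k fls \<Rightarrow> 'c) set" where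
  "C0 \<iota> = {f. continuous_on int_ring f \<and>
     (\<forall>s\<in>int_ring. \<forall>t\<in>int_ring. f (s + t) = f s + f t) \<and>
     (\<forall>\<alpha>. \<forall>t\<in>int_ring. f (fls_const \<alpha> * t) = \<iota> (fls_const \<alpha>) * f t)}"

definition sup_norm :: "('k::{field,finite} fls \<Rightarrow> 'c::{field,metric_space}) \<Rightarrow> real" where
  "sup_norm f = (SUP t\<in>int_ring. vabs (f t))"

definition expansion ::
    "(nat \<Rightarrow> 'k::{field,finite} fls \<Rightarrow> 'c::{field,metric_space}) \<Rightarrow> (nat \<Rightarrow> 'c) \<Rightarrow> ('k fls \<Rightarrow> 'c) \<Rightarrow> bool" where
  "expansion e c f \<longleftrightarrow>
     uniform_limit int_ring (\<lambda>N t. \<Sum>n<N. c n * e n t) f sequentially"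

text \<open>Orthonormality is meant in the sense of non-archimedean Banach spaces.\<close>

definition orthonormal_basis ::
    "('k::{field,finite} fls \<Rightarrow> 'c::{field,metric_space}) \<Rightarrow> (nat \<Rightarrow> 'k fls \<Rightarrow> 'c) \<Rightarrow> bool" where
  "orthonormal_basis \<iota> e \<longleftrightarrow>
     (\<forall>n. e n \<in> C0 \<iota>) \<and>
     (\<forall>f\<in>C0 \<iota>. \<exists>c. c \<longlonglongrightarrow> 0 \<and> expansion e c f \<and> sup_norm f = (SUP n. vabs (c n)) \<and>
        (\<forall>c'. c' \<longlonglongrightarrow> 0 \<and> expansion e c' f \<longrightarrow> c' = c))"

section \<open>Linear polynomials and their operators\<close>

definition lin_polys :: "nat \<Rightarrow> 'c::field poly set" where
  "lin_polys q = {u. \<forall>i. Polynomial.coeff u i \<noteq> 0 \<longrightarrow> (\<exists>k. i = q ^ k)}"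

text \<open>In a completed algebraic closure of \<open>K\<close> the \<open>q\<close>-th root exists and is unique.\<close>

definition qroot :: "nat \<Rightarrow> 'c::field \<Rightarrow> 'c" where
  "qroot q a = (THE b. b ^ q = a)"

definition dilate :: "('k::field fls \<Rightarrow> 'c::field) \<Rightarrow> 'k fls \<Rightarrow> 'c poly \<Rightarrow> 'c poly" where
  "dilate \<iota> a u = pcompose u [:0, \<iota> a:]"

definition tau :: "nat \<Rightarrow> 'c::field poly \<Rightarrow> 'c poly" where
  "tau q u = u ^ q"

text \<open>Only meaningful on linear polynomials without linear term; as \<open>k \<le> q ^ k\<close>, the bound
  \<open>k \<le> degree u\<close> omits no term.\<close>

definition tau_inv :: "nat \<Rightarrow> 'c::field poly \<Rightarrow> 'c poly" where
  "tau_inv q u = (\<Sum>k\<in>{1..Polynomial.degree u}.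
     Polynomial.monom (qroot q (Polynomial.coeff u (q ^ k))) (q ^ (k - 1)))"

definition Delta :: "('k::field fls \<Rightarrow> 'c::field) \<Rightarrow> 'c poly \<Rightarrow> 'c poly" where
  "Delta \<iota> u = dilate \<iota> fls_X u - Polynomial.smult (\<iota> fls_X) u"

definition carlitz_d :: "nat \<Rightarrow> ('k::field fls \<Rightarrow> 'c::field) \<Rightarrow> 'c poly \<Rightarrow> 'c poly" where
  "carlitz_d q \<iota> u = tau_inv q (Delta \<iota> u)"

text \<open>\<open>divided_power q d n\<close> is \<open>\<tau>\<^sup>n d\<^sup>n\<close>; it gives both \<open>\<Delta>\<^sup>(\<^sup>l\<^sup>)\<close> (for the Carlitz derivative) and
  \<open>\<delta>\<^sub>0\<^sup>(\<^sup>n\<^sup>)\<close> (for a delta operator).\<close>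

definition divided_power :: "nat \<Rightarrow> ('c::field poly \<Rightarrow> 'c poly) \<Rightarrow> nat \<Rightarrow> 'c poly \<Rightarrow> 'c poly" where
  "divided_power q d n u = (tau q ^^ n) ((d ^^ n) u)"

definition Delta_pow :: "nat \<Rightarrow> ('k::field fls \<Rightarrow> 'c::field) \<Rightarrow> nat \<Rightarrow> 'c poly \<Rightarrow> 'c poly" where
  "Delta_pow q \<iota> l = divided_power q (carlitz_d q \<iota>) l"

text \<open>The operator \<open>\<Sum>l\<ge>1. \<sigma> l \<Delta>\<^sup>(\<^sup>l\<^sup>)\<close>; the index set is finite by \<open>finite_Delta_pow_support\<close> below.\<close>

definition Delta_series ::
    "nat \<Rightarrow> ('k::field fls \<Rightarrow> 'c::field) \<Rightarrow> (nat \<Rightarrow> 'c) \<Rightarrow> 'c poly \<Rightarrow> 'c poly" where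
  "Delta_series q \<iota> \<sigma> u =
     (\<Sum>l\<in>{l. 1 \<le> l \<and> Delta_pow q \<iota> l u \<noteq> 0}. Polynomial.smult (\<sigma> l) (Delta_pow q \<iota> l u))"

definition linear_operator :: "nat \<Rightarrow> ('c::field poly \<Rightarrow> 'c poly) \<Rightarrow> bool" where
  "linear_operator q T \<longleftrightarrow>
     (\<forall>u\<in>lin_polys q. T u \<in> lin_polys q) \<and>
     (\<forall>u\<in>lin_polys q. \<forall>v\<in>lin_polys q. T (u + v) = T u + T v) \<and>
     (\<forall>c. \<forall>u\<in>lin_polys q. T (Polynomial.smult c u) = Polynomial.smult c (T u))"

definition invariant_operator ::
    "nat \<Rightarrow> ('k::field fls \<Rightarrow> 'c::field) \<Rightarrow> ('c poly \<Rightarrow> 'c poly) \<Rightarrow> bool" where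
  "invariant_operator q \<iota> T \<longleftrightarrow>
     (\<forall>a. \<forall>u\<in>lin_polys q. T (dilate \<iota> a u) = dilate \<iota> a (T u))"

definition delta_operator ::
    "nat \<Rightarrow> ('k::field fls \<Rightarrow> 'c::field) \<Rightarrow> ('c poly \<Rightarrow> 'c poly) \<Rightarrow> bool" where
  "delta_operator q \<iota> \<delta> \<longleftrightarrow>
     (\<exists>\<delta>0. linear_operator q \<delta>0 \<and> invariant_operator q \<iota> \<delta>0 \<and>
        \<delta>0 (Polynomial.monom 1 1) = 0 \<and>
        (\<forall>n\<ge>1. \<exists>c. c \<noteq> 0 \<and> \<delta>0 (Polynomial.monom 1 (q ^ n)) = Polynomial.monom c (q ^ n)) \<and>
        (\<forall>u\<in>lin_polys q. \<delta> u = tau_inv q (\<delta>0 u)))"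

definition bracket :: "nat \<Rightarrow> nat \<Rightarrow> 'k::field fls" where
  "bracket q i = fls_X ^ (q ^ i) - fls_X"

definition carlitz_D :: "nat \<Rightarrow> nat \<Rightarrow> 'k::field fls" where
  "carlitz_D q i = (\<Prod>j\<in>{1..i}. bracket q j ^ (q ^ (i - j)))"

definition basic_sequence ::
    "nat \<Rightarrow> ('k::field fls \<Rightarrow> 'c::field) \<Rightarrow> ('c poly \<Rightarrow> 'c poly) \<Rightarrow> (nat \<Rightarrow> 'c poly) \<Rightarrow> bool" where
  "basic_sequence q \<iota> \<delta> P \<longleftrightarrow>
     (\<forall>n. P n \<in> lin_polys q \<and> Polynomial.degree (P n) = q ^ n) \<and>
     poly (P 0) 1 = 1 \<and> (\<forall>n\<ge>1. poly (P n) 1 = 0) \<and>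
     \<delta> (P 0) = 0 \<and>
     (\<forall>n\<ge>1. \<delta> (P n) = Polynomial.smult (qroot q (\<iota> (bracket q n))) (P (n - 1)))"

definition lin_approx ::
    "nat \<Rightarrow> ('k::{field,finite} fls \<Rightarrow> 'c::{field,metric_space}) \<Rightarrow> (nat \<Rightarrow> 'c poly) \<Rightarrow> ('k fls \<Rightarrow> 'c) \<Rightarrow> bool" where
  "lin_approx q \<iota> F f \<longleftrightarrow>
     (\<forall>N. F N \<in> lin_polys q) \<and>
     uniform_limit int_ring (\<lambda>N t. poly (F N) (\<iota> t)) f sequentially"

text \<open>\<open>delta_value q \<iota> \<delta> n f y\<close> says that \<open>(\<delta>\<^sub>0\<^sup>(\<^sup>n\<^sup>) f)(1)\<close>, defined by continuous extension from linear
  polynomials, exists and equals \<open>y\<close>.  The first conjunct excludes a vacuous second one.\<close>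

definition delta_value ::
    "nat \<Rightarrow> ('k::{field,finite} fls \<Rightarrow> 'c::{field,metric_space}) \<Rightarrow> ('c poly \<Rightarrow> 'c poly) \<Rightarrow> nat
       \<Rightarrow> ('k fls \<Rightarrow> 'c) \<Rightarrow> 'c \<Rightarrow> bool" where
  "delta_value q \<iota> \<delta> n f y \<longleftrightarrow>
     (\<exists>F. lin_approx q \<iota> F f) \<and>
     (\<forall>F. lin_approx q \<iota> F f \<longrightarrow> (\<lambda>N. poly (divided_power q \<delta> n (F N)) 1) \<longlonglongrightarrow> y)"

lemma delta_value_unique:
  assumes "delta_value q \<iota> \<delta> n f y" "delta_value q \<iota> \<delta> n f z"
  shows "y = z"
  using assms unfolding delta_value_def by (blast intro: LIMSEQ_unique)

lemma degree_Delta_le: "Polynomial.degree (Delta \<iota> u) \<le> Polynomial.degree u"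
  unfolding Delta_def dilate_def
  by (intro degree_diff_le order.trans[OF degree_pcompose_le] degree_smult_le) auto

lemma degree_tau_inv_less:
  assumes "1 < q" "0 < Polynomial.degree u"
  shows "Polynomial.degree (tau_inv q u) < Polynomial.degree u"
proof -
  have "Polynomial.degree (Polynomial.monom (qroot q (Polynomial.coeff u (q ^ k))) (q ^ (k - 1))
          :: 'a poly) < Polynomial.degree u"
    if k: "k \<in> {1..Polynomial.degree u}" for k
  proof (cases "qroot q (Polynomial.coeff u (q ^ k)) = 0")
    case True
    then show ?thesis using assms by simp
  next
    case False
    have "qroot q (0::'a) = 0"
      unfolding qroot_def using assms by (intro the_equality) auto
    with False have "Polynomial.coeff u (q ^ k) \<noteq> 0" by auto
    then have "q ^ k \<le> Polynomial.degree u" by (rule le_degree)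
    moreover have "q ^ (k - 1) < q ^ k" using assms k by (intro power_strict_increasing) auto
    ultimately show ?thesis using False by (simp add: degree_monom_eq)
  qed
  then show ?thesis
    unfolding tau_inv_def using assms by (intro degree_sum_less) auto
qed

lemma finite_Delta_pow_support:
  fixes u :: "'c::field poly"
  assumes "1 < q"
  shows "finite {l. 1 \<le> l \<and> Delta_pow q \<iota> l u \<noteq> 0}"
proof -
  have step: "Polynomial.degree (carlitz_d q \<iota> v) < Polynomial.degree v \<or> carlitz_d q \<iota> v = 0"
    for v
  proof (cases "Polynomial.degree (Delta \<iota> v) = 0")
    case True
    then show ?thesis by (simp add: carlitz_d_def tau_inv_def)
  next
    case False
    then show ?thesis
      using degree_tau_inv_less[OF assms, of "Delta \<iota> v"] degree_Delta_le[of \<iota> v]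
      by (auto simp: carlitz_d_def)
  qed
  have zero: "carlitz_d q \<iota> 0 = 0"
    by (simp add: carlitz_d_def tau_inv_def Delta_def dilate_def)
  have "(carlitz_d q \<iota> ^^ l) u = 0 \<or> Polynomial.degree ((carlitz_d q \<iota> ^^ l) u) + l \<le> Polynomial.degree u"
    for l
  proof (induction l)
    case (Suc l)
    then show ?case using step[of "(carlitz_d q \<iota> ^^ l) u"] zero by auto
  qed simp
  then have "(carlitz_d q \<iota> ^^ l) u = 0" if "Polynomial.degree u < l" for l
    using that by (metis add_leD2 leD)
  moreover have "(tau q ^^ l) 0 = (0 :: 'c poly)" for l
    by (induction l) (use assms in \<open>auto simp: tau_def\<close>)
  ultimately have "Delta_pow q \<iota> l u = 0" if "Polynomial.degree u < l" for l
    using that by (simp add: Delta_pow_def divided_power_def)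
  then have "{l. 1 \<le> l \<and> Delta_pow q \<iota> l u \<noteq> 0} \<subseteq> {..Polynomial.degree u}"
    by (auto simp: not_less[symmetric])
  then show ?thesis by (rule finite_subset) simp
qed

end

theory Submission
  imports Defs
begin

text \<open>Let \<open>x\<close> be the image of \<open>X\<close> in the completed closure.  The recursion
  \<open>\<Delta>\<^sup>(\<^sup>l\<^sup>+\<^sup>1\<^sup>) u(t) = \<Delta>\<^sup>(\<^sup>l\<^sup>) u(xt) - x^(q^l) \<Delta>\<^sup>(\<^sup>l\<^sup>) u(t)\<close> shows that each \<open>\<Delta>\<^sup>(\<^sup>l\<^sup>)\<close> contracts the sup
  norm and agrees with \<open>u(t) \<mapsto> u(x^l t)\<close> up to a factor \<open>1/q\<close>.  Hence \<open>\<parallel>\<delta>\<^sub>0 u\<parallel> \<le> \<parallel>u\<parallel>\<close>, so the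
  functionals \<open>u \<mapsto> (\<delta>\<^sub>0\<^sup>(\<^sup>n\<^sup>) u)(1)\<close>, which are biorthogonal to the \<open>Q n\<close> because
  \<open>\<delta> (Q n) = Q (n - 1)\<close>, have norm at most 1.  A continuous linear function is determined by its
  values at the powers of \<open>x\<close>, and there \<open>\<delta>\<^sub>0\<close> is, modulo \<open>1/q\<close>, a one-sided shift with leading
  coefficient the unit \<open>\<sigma> 1\<close>; therefore \<open>\<delta>\<^sub>0 (Q (n + 1)) = Q n ^ q\<close> and \<open>Q (n + 1)\<close> vanishing at 1
  force \<open>\<parallel>Q (n + 1)\<parallel> \<le> 1\<close>.  Modulo \<open>1/q\<close> the matrix of values \<open>Q n (x^j)\<close> is triangular with unit
  diagonal, so linear polynomials are dense.\<close>

section \<open>The base field and its completed closure\<close>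

text \<open>Multiplication by a nonzero \<open>a\<close> permutes the nonzero elements, so their
  product picks up the factor \<open>a ^ (CARD('k) - 1)\<close> and yet is unchanged.\<close>

lemma finite_field_power_card:
  fixes a :: "'k::{field,finite}"
  shows "a ^ CARD('k) = a"
proof (cases "a = 0")
  case False
  have "(\<Prod>y\<in>UNIV - {0}. a * y) = (\<Prod>y\<in>UNIV - {0}. y)"
    by (rule prod.reindex_bij_witness[of _ "\<lambda>y. y / a" "\<lambda>y. a * y"]) (use False in auto)
  then have "a ^ (CARD('k) - 1) * \<Prod>(UNIV - {0}) = \<Prod>(UNIV - {0::'k})"
    by (simp add: prod.distrib)
  moreover have "\<Prod>(UNIV - {0::'k}) \<noteq> 0" by simp
  ultimately have "a ^ (CARD('k) - 1) = 1" by simp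
  then have "a * a ^ (CARD('k) - 1) = a" by simp
  then show ?thesis by (simp flip: power_Suc)
qed simp

text \<open>Translation by \<open>1\<close> permutes the field, so summing \<open>y + 1\<close> over
  all \<open>y\<close> adds \<open>CARD('k)\<close> ones without changing the sum.\<close>

lemma of_nat_card_eq_0: "of_nat CARD('k) = (0::'k::{field,finite})"
proof -
  have "(\<Sum>y\<in>UNIV. y + 1) = (\<Sum>y\<in>UNIV. y :: 'k)"
    by (rule sum.reindex_bij_witness[of _ "\<lambda>y. y - 1" "\<lambda>y. y + 1"]) auto
  then show ?thesis by (simp add: sum.distrib)
qed

lemma one_less_card_field: "1 < CARD('k::{field,finite})"
proof -
  have "card {0, 1 :: 'k} \<le> CARD('k)" by (intro card_mono) auto
  then show ?thesis by simp
qed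

section \<open>Coefficient descriptions of the ring of integers and of small balls\<close>

lemma fls_abs_le_iff:
  fixes z :: "'k::{field,finite} fls"
  shows "fls_abs z \<le> real CARD('k) powi (- n) \<longleftrightarrow> (\<forall>k<n. fls_nth z k = 0)"
proof (cases "z = 0")
  case False
  have "fls_abs z \<le> real CARD('k) powi (- n) \<longleftrightarrow> n \<le> fls_subdegree z"
  proof
    assume "fls_abs z \<le> real CARD('k) powi (- n)"
    then have "\<not> real CARD('k) powi (- n) < real CARD('k) powi (- fls_subdegree z)"
      using False by (simp add: fls_abs_def)
    then show "n \<le> fls_subdegree z"
      using one_less_card_field[where 'k='k]
        power_int_strict_increasing[of "- n" "- fls_subdegree z" "real CARD('k)"] by linarith
  next
    assume "n \<le> fls_subdegree z"
    then show "fls_abs z \<le> real CARD('k) powi (- n)"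
      using False one_less_card_field[where 'k='k]
      by (auto simp: fls_abs_def intro!: power_int_increasing)
  qed
  also have "\<dots> \<longleftrightarrow> (\<forall>k<n. fls_nth z k = 0)"
    using False by (meson fls_subdegree_geI fls_eq0_below_subdegree less_le_trans)
  finally show ?thesis .
qed (simp add: fls_abs_def)

lemma int_ring_iff: "z \<in> int_ring \<longleftrightarrow> (\<forall>k<0. fls_nth z k = 0)"
  using fls_abs_le_iff[of z 0] by (simp add: int_ring_def)

lemma int_ring_0: "0 \<in> int_ring" and int_ring_1: "1 \<in> int_ring"
  and int_ring_add: "s \<in> int_ring \<Longrightarrow> t \<in> int_ring \<Longrightarrow> s + t \<in> int_ring"
  and int_ring_diff: "s \<in> int_ring \<Longrightarrow> t \<in> int_ring \<Longrightarrow> s - t \<in> int_ring"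
  and int_ring_X_power: "fls_X ^ n \<in> int_ring"
  by (auto simp: int_ring_iff)

lemma int_ring_mult:
  assumes "s \<in> int_ring" "t \<in> int_ring"
  shows "s * t \<in> int_ring"
proof (cases "s = 0 \<or> t = 0")
  case False
  with assms have "0 \<le> fls_subdegree s" "0 \<le> fls_subdegree t"
    by (auto simp: int_ring_iff intro: fls_subdegree_geI)
  with False have "0 \<le> fls_subdegree (s * t)" by simp
  then show ?thesis by (auto simp: int_ring_iff)
qed (auto simp: int_ring_0)

lemma int_ring_const: "fls_const a \<in> int_ring"
  by (auto simp: int_ring_iff)

text \<open>Links the base-2 metric to \<open>fls_abs\<close>: both measure the order of vanishing.
  The strict bound makes coefficient \<open>n\<close> itself vanish as well.\<close>

lemma dist_0_fls_less:
  fixes z :: "'k::field fls"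
  shows "dist z 0 < inverse (2 ^ n) \<longleftrightarrow> (\<forall>k\<le>int n. fls_nth z k = 0)"
proof (cases "z = 0")
  case False
  have "dist z 0 < inverse (2 ^ n) \<longleftrightarrow> int n < fls_subdegree z"
  proof (cases "0 \<le> fls_subdegree z")
    case True
    then show ?thesis using False by (auto simp: dist_fls_def zless_nat_eq_int_zless)
  next
    case neg: False
    \<comment> \<open>Negative subdegree puts \<open>z\<close> at distance at least 1, so both sides
      of the equivalence fail.\<close>
    have "inverse (2 ^ n) \<le> (1::real)" by (simp add: inverse_le_1_iff)
    also have "1 \<le> (2::real) ^ nat (- fls_subdegree z)" by simp
    finally show ?thesis using False neg by (simp add: dist_fls_def)
  qed
  also have "\<dots> \<longleftrightarrow> (\<forall>k\<le>int n. fls_nth z k = 0)"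
  proof
    assume "int n < fls_subdegree z"
    then show "\<forall>k\<le>int n. fls_nth z k = 0" by auto
  next
    assume "\<forall>k\<le>int n. fls_nth z k = 0"
    then show "int n < fls_subdegree z"
      using nth_fls_subdegree_nonzero[OF False] by (meson not_le)
  qed
  finally show ?thesis .
qed simp

locale completed_closure =
  fixes p \<nu> q :: nat
    and \<iota> :: "'k::{field,finite} fls \<Rightarrow> 'c::{field,complete_space}"
  assumes prime_p: "Factorial_Ring.prime p" and q_eq: "q = p ^ \<nu>" and card_k: "CARD('k) = q"
    and closure_\<iota>: "completed_alg_closure \<iota>"
begin

section \<open>The embedding of K, the characteristic, and additivity of Frobenius\<close>

lemma dist_vabs: "\<And>u v :: 'c. dist u v = vabs (u - v)"
  and vabs_mult: "\<And>u v :: 'c. vabs (u * v) = vabs u * vabs v"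
  and vabs_add: "\<And>u v :: 'c. vabs (u + v) \<le> max (vabs u) (vabs v)"
  and vabs_\<iota>: "vabs (\<iota> z) = fls_abs z"
  using closure_\<iota> unfolding completed_alg_closure_def by blast+

text \<open>\<open>\<iota>\<close> is \<open>to_ac\<close> followed by the homomorphism
  \<open>j\<close>, and inherits these laws.\<close>

lemma \<iota>_1: "\<iota> 1 = 1" and \<iota>_add: "\<iota> (a + b) = \<iota> a + \<iota> b" and \<iota>_mult: "\<iota> (a * b) = \<iota> a * \<iota> b"
  using closure_\<iota> unfolding completed_alg_closure_def by (metis to_ac_1 to_ac_add to_ac_mult)+

lemma \<iota>_0: "\<iota> 0 = 0"
  using \<iota>_add[of 0 0] by (metis add.right_neutral add_left_cancel)

lemma \<iota>_diff: "\<iota> (a - b) = \<iota> a - \<iota> b"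
  using \<iota>_add[of "a - b" b] by simp

lemma \<iota>_power: "\<iota> (a ^ n) = \<iota> a ^ n"
  by (induction n) (simp_all add: \<iota>_1 \<iota>_mult)

lemma \<iota>_of_nat: "\<iota> (of_nat n) = of_nat n"
  by (induction n) (simp_all add: \<iota>_0 \<iota>_1 \<iota>_add)

lemma \<iota>_eq_0_iff: "\<iota> a = 0 \<longleftrightarrow> a = 0"
  using \<iota>_mult[of a "inverse a"] by (cases "a = 0") (auto simp: \<iota>_0 \<iota>_1)

lemma one_less_q: "1 < q"
  using one_less_card_field[where 'k='k] card_k by simp

text \<open>Since its power \<open>q\<close> is zero in the finite field, so is \<open>p\<close>,
  and \<open>\<iota>\<close> carries this over; a divisor of the prime \<open>p\<close> other than 1
  is \<open>p\<close>.\<close>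

lemma CHAR_eq: "CHAR('c) = p"
proof -
  have "of_nat p ^ \<nu> = (0::'k)"
    using of_nat_card_eq_0[where 'k='k] by (simp add: card_k q_eq)
  then have "of_nat p = (0::'k)" by simp
  then have "of_nat p = (0::'k fls)" by (simp add: fls_of_nat)
  then have "of_nat p = (0::'c)" using \<iota>_of_nat[of p] by (simp add: \<iota>_0)
  then have "CHAR('c) dvd p" by (simp add: of_nat_eq_0_iff_char_dvd)
  moreover have "CHAR('c) \<noteq> 1" by simp
  ultimately show ?thesis using prime_p by (metis prime_nat_iff)
qed

lemma q_pow_eq: "q ^ k = CHAR('c) ^ (\<nu> * k)"
  by (simp add: CHAR_eq q_eq power_mult)

text \<open>\<open>q ^ k\<close> is a power of the characteristic. All additivity and all root
  extraction below rest on this.\<close>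

lemma add_power_q: "(a + b) ^ (q ^ k) = a ^ (q ^ k) + b ^ (q ^ k)" for a b :: 'c
  by (rule freshmans_dream'[OF _ q_pow_eq]) (simp add: CHAR_eq prime_p)

lemma poly_add_power_q: "(u + v) ^ (q ^ k) = u ^ (q ^ k) + v ^ (q ^ k)" for u v :: "'c poly"
  by (rule freshmans_dream'[where n = "\<nu> * k"]) (simp_all add: CHAR_eq prime_p q_eq power_mult)

lemma poly_sum_power_q: "sum f A ^ (q ^ k) = (\<Sum>i\<in>A. f i ^ (q ^ k))" for f :: "'a \<Rightarrow> 'c poly"
  by (rule freshmans_dream_sum'[where n = "\<nu> * k"]) (simp_all add: CHAR_eq prime_p q_eq power_mult)

lemma diff_power_q: "(a - b) ^ (q ^ k) = a ^ (q ^ k) - b ^ (q ^ k)" for a b :: 'c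
  using add_power_q[of "a - b" b k] by simp

lemma poly_diff_power_q: "(u - v) ^ (q ^ k) = u ^ (q ^ k) - v ^ (q ^ k)" for u v :: "'c poly"
  using poly_add_power_q[of "u - v" v k] by simp

section \<open>Ultrametric arithmetic\<close>

lemma vabs_0 [simp]: "vabs (0::'c) = 0"
  by (simp add: vabs_def)

lemma vabs_nonneg [simp]: "0 \<le> vabs (u::'c)"
  by (simp add: vabs_def)

lemma vabs_eq_0_iff [simp]: "vabs u = 0 \<longleftrightarrow> u = 0" for u :: 'c
  by (simp add: vabs_def)

lemma vabs_1 [simp]: "vabs (1::'c) = 1"
  using vabs_mult[of 1 1] by simp

lemma vabs_power: "vabs (u ^ n) = vabs u ^ n" for u :: 'c
  by (induction n) (simp_all add: vabs_mult)

lemma vabs_minus [simp]: "vabs (- u) = vabs u" for u :: 'c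
proof -
  have "vabs (- 1 :: 'c) ^ 2 = 1" by (simp flip: vabs_power)
  then have "vabs (- 1 :: 'c) = 1" using vabs_nonneg[of "- 1"] by (simp add: power2_eq_1_iff)
  then show ?thesis using vabs_mult[of "- 1" u] by simp
qed

lemma vabs_minus_commute: "vabs (u - v) = vabs (v - u)" for u v :: 'c
  using vabs_minus[of "u - v"] by simp

lemma vabs_add_le: "vabs u \<le> B \<Longrightarrow> vabs v \<le> B \<Longrightarrow> vabs (u + v) \<le> B" for u v :: 'c
  using vabs_add[of u v] by simp

lemma vabs_diff_le: "vabs u \<le> B \<Longrightarrow> vabs v \<le> B \<Longrightarrow> vabs (u - v) \<le> B" for u v :: 'c
  using vabs_add_le[of u B "- v"] by simp

lemma vabs_diff_less: "vabs u < B \<Longrightarrow> vabs v < B \<Longrightarrow> vabs (u - v) < B" for u v :: 'c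
  using vabs_add[of u "- v"] by simp

text \<open>Writing \<open>u = (u + v) - v\<close>, the ultrametric inequality bounds
  \<open>vabs u\<close> by the larger of \<open>vabs (u + v)\<close> and \<open>vabs v\<close>, and
  strictness rules out the latter.\<close>

lemma vabs_add_eq:
  assumes "vabs v < vabs (u::'c)"
  shows "vabs (u + v) = vabs u"
  using vabs_add[of u v] vabs_add[of "u + v" "- v"] assms by auto

lemma vabs_sum_le:
  fixes f :: "'a \<Rightarrow> 'c"
  assumes "0 \<le> B" "\<And>i. i \<in> A \<Longrightarrow> vabs (f i) \<le> B"
  shows "vabs (sum f A) \<le> B"
  using assms by (induction A rule: infinite_finite_induct) (auto intro: vabs_add_le)

lemma tendsto_vabs_iff: "(f \<longlongrightarrow> l) F \<longleftrightarrow> ((\<lambda>n. vabs (f n - l)) \<longlongrightarrow> 0) F" for l :: 'c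
  by (subst tendsto_dist_iff) (simp add: dist_vabs)

lemma vabs_le_1: "t \<in> int_ring \<Longrightarrow> vabs (\<iota> t) \<le> 1"
  by (simp add: vabs_\<iota> int_ring_def)

lemma vabs_X: "vabs (\<iota> fls_X) = 1 / q"
  by (simp add: vabs_\<iota> fls_abs_def card_k power_int_minus field_simps)

section \<open>Uniqueness and existence of q-th roots\<close>

lemma qroot_unique: "a ^ q = b ^ q \<longleftrightarrow> a = b" for a b :: 'c
proof
  assume "a ^ q = b ^ q"
  then have "(a - b) ^ q = 0" using diff_power_q[of a b 1] by simp
  then show "a = b" by simp
qed simp

lemma poly_qroot_unique: "u ^ q = v ^ q \<longleftrightarrow> u = v" for u v :: "'c poly"
proof
  assume "u ^ q = v ^ q"
  then have "(u - v) ^ q = 0" using poly_diff_power_q[of u v 1] by simp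
  then show "u = v" by simp
qed simp

text \<open>By \<open>|r - s|^q = |r^q - s^q|\<close>, taking \<open>q\<close>-th roots is uniformly continuous, so it extends from
  the dense algebraic closure to its completion.\<close>

lemma qroot_exists: "\<exists>b. b ^ q = (a::'c)"
proof -
  obtain j :: "'k fls alg_closure \<Rightarrow> 'c" where j1: "j 1 = 1"
    and jm: "\<And>a b. j (a * b) = j a * j b" and dense: "closure (range j) = UNIV"
    using closure_\<iota> unfolding completed_alg_closure_def by blast
  have j_pow: "j (b ^ n) = j b ^ n" for b n
    by (induction n) (simp_all add: j1 jm)
  have "a \<in> closure (range j)" using dense by simp
  then obtain s where s: "\<And>n. s n \<in> range j" and lim: "s \<longlonglongrightarrow> a"
    unfolding closure_sequential by blast
  have "\<exists>b. b ^ q = s n" for n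
  proof -
    obtain c where c: "s n = j c" using s[of n] by blast
    have "\<exists>b. b ^ q = c"
    proof -
      \<comment> \<open>Coefficients of \<open>X^q - c\<close>, whose zero in the algebraic closure
        is the wanted root.\<close>
      define f where "f k = (if k = q then 1 else if k = 0 then - c else 0)" for k
      obtain b where "(\<Sum>k\<le>q. f k * b ^ k) = 0"
        using alg_closed[of q f] one_less_q by (auto simp: f_def)
      moreover have "(\<Sum>k\<le>q. f k * b ^ k) = (\<Sum>k\<in>{0, q}. f k * b ^ k)"
        by (intro sum.mono_neutral_right) (auto simp: f_def)
      ultimately show ?thesis using one_less_q by (auto simp: f_def)
    qed
    then show ?thesis using j_pow c by metis
  qed
  then obtain r where r: "\<And>n. r n ^ q = s n" by metis
  have pow: "vabs (u - v) ^ q = vabs (u ^ q - v ^ q)" for u v :: 'c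
    using diff_power_q[of u v 1] by (simp flip: vabs_power)
  have "Cauchy r"
    unfolding Cauchy_def
  proof (intro allI impI)
    fix e :: real assume "0 < e"
    then have "0 < e ^ q" by simp
    then obtain M where "\<forall>m\<ge>M. \<forall>n\<ge>M. dist (s m) (s n) < e ^ q"
      using LIMSEQ_imp_Cauchy[OF lim] unfolding Cauchy_def by blast
    then have "\<forall>m\<ge>M. \<forall>n\<ge>M. vabs (r m - r n) ^ q < e ^ q"
      by (simp add: pow r dist_vabs)
    then have "\<forall>m\<ge>M. \<forall>n\<ge>M. vabs (r m - r n) < e"
      using \<open>0 < e\<close> by (meson less_imp_le power_less_imp_less_base)
    then have "\<forall>m\<ge>M. \<forall>n\<ge>M. dist (r m) (r n) < e"
      by (simp add: dist_vabs)
    then show "\<exists>M. \<forall>m\<ge>M. \<forall>n\<ge>M. dist (r m) (r n) < e" by blast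
  qed
  then obtain b where b: "r \<longlonglongrightarrow> b" using Cauchy_convergent_iff convergent_def by blast
  have "(\<lambda>n. vabs (r n - b) ^ q) \<longlonglongrightarrow> 0 ^ q"
    using b tendsto_vabs_iff by (intro tendsto_power) auto
  then have "s \<longlonglongrightarrow> b ^ q"
    using one_less_q by (subst tendsto_vabs_iff) (simp add: pow r zero_power)
  with lim have "a = b ^ q" by (rule LIMSEQ_unique)
  then show ?thesis by blast
qed

lemma qroot_power: "qroot q a ^ q = (a::'c)"
proof -
  have "\<exists>!b. b ^ q = a" using qroot_exists qroot_unique by metis
  then show ?thesis unfolding qroot_def by (rule theI')
qed

section \<open>Linear polynomials and the operators \<open>\<Delta>\<^sup>(\<^sup>l\<^sup>)\<close>\<close>

abbreviation LP :: "'c poly set" where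
  "LP \<equiv> lin_polys q"

lemma poly_eqI_lin:
  assumes "u \<in> LP" "v \<in> LP"
    and "\<And>k. Polynomial.coeff u (q ^ k) = Polynomial.coeff v (q ^ k)"
  shows "u = (v :: 'c poly)"
proof (rule poly_eqI)
  fix i show "Polynomial.coeff u i = Polynomial.coeff v i"
  proof (cases "\<exists>k. i = q ^ k")
    case False
    then have "Polynomial.coeff u i = 0" "Polynomial.coeff v i = 0"
      using assms(1,2) unfolding lin_polys_def by blast+
    then show ?thesis by simp
  qed (use assms(3) in auto)
qed

lemma lin_0: "0 \<in> LP"
  by (simp add: lin_polys_def)

lemma lin_add:
  assumes "u \<in> LP" "v \<in> LP"
  shows "u + v \<in> LP"
  unfolding lin_polys_def
proof (intro CollectI allI impI)
  fix i assume "Polynomial.coeff (u + v) i \<noteq> 0"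
  then have "Polynomial.coeff u i \<noteq> 0 \<or> Polynomial.coeff v i \<noteq> 0" by auto
  then show "\<exists>k. i = q ^ k" using assms unfolding lin_polys_def by blast
qed

lemma lin_smult: "u \<in> LP \<Longrightarrow> Polynomial.smult c u \<in> LP" for u :: "'c poly"
  by (auto simp: lin_polys_def)

lemma lin_diff: "u \<in> LP \<Longrightarrow> v \<in> LP \<Longrightarrow> u - v \<in> LP" for u v :: "'c poly"
  using lin_add[of u "Polynomial.smult (- 1) v"] lin_smult[of v "- 1"] by simp

lemma lin_sum: "(\<And>i. i \<in> A \<Longrightarrow> f i \<in> LP) \<Longrightarrow> sum f A \<in> LP" for f :: "'a \<Rightarrow> 'c poly"
  by (induction A rule: infinite_finite_induct) (auto intro: lin_add lin_0)

lemma lin_monom: "Polynomial.monom c (q ^ k) \<in> LP"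
  by (auto simp: lin_polys_def)

lemma q_power_inject: "q ^ k = q ^ m \<longleftrightarrow> k = m"
  using one_less_q by simp

lemma less_q_power: "n < q ^ n"
  using one_less_q by (simp add: power_gt_expt)

text \<open>Letting \<open>k\<close> run up to the degree avoids logarithms and loses nothing,
  because \<open>k < q ^ k\<close>.\<close>

lemma lin_as_sum:
  assumes "u \<in> LP"
  shows "u = (\<Sum>k\<in>{..Polynomial.degree u}. Polynomial.monom (Polynomial.coeff u (q ^ k)) (q ^ k))"
proof (rule poly_eqI_lin[OF assms])
  fix m
  have "Polynomial.coeff u (q ^ m) = 0" if "\<not> m \<le> Polynomial.degree u"
    using that less_q_power[of m] by (intro coeff_eq_0) simp
  then show "Polynomial.coeff u (q ^ m) =
      Polynomial.coeff (\<Sum>k\<in>{..Polynomial.degree u}. Polynomial.monom (Polynomial.coeff u (q ^ k)) (q ^ k)) (q ^ m)"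
    by (auto simp: coeff_sum q_power_inject cong: if_cong)
qed (intro lin_sum lin_monom)

text \<open>Reduces additive statements about linear polynomials to monomials, where they become
  facts on \<open>q ^ k\<close>-th powers.\<close>

lemma lin_induct [consumes 1, case_names zero monom add]:
  assumes "u \<in> LP"
    and "R 0" "\<And>c k. R (Polynomial.monom c (q ^ k))"
    and add: "\<And>u v. u \<in> LP \<Longrightarrow> v \<in> LP \<Longrightarrow> R u \<Longrightarrow> R v \<Longrightarrow> R (u + v)"
  shows "R (u :: 'c poly)"
proof -
  have "R (\<Sum>k\<in>A. Polynomial.monom (f k) (q ^ k))" if "finite A" for A and f :: "nat \<Rightarrow> 'c"
    using that by (induction A) (auto intro!: assms(2-3) add lin_sum lin_monom)
  then show ?thesis by (subst lin_as_sum[OF assms(1)]) simp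
qed

lemma poly_lin_add:
  assumes "u \<in> LP"
  shows "poly u (a + b) = poly u a + poly u (b::'c)"
  using assms
  by (induction rule: lin_induct) (auto simp: poly_monom add_power_q distrib_left)

lemma const_power_q: "a ^ (q ^ k) = (a::'k)"
  using finite_field_power_card[of a] card_k by (induction k) (simp_all add: power_mult mult.commute)

lemma poly_lin_const:
  assumes "u \<in> LP"
  shows "poly u (\<iota> (fls_const \<alpha>) * a) = \<iota> (fls_const \<alpha>) * poly u a"
proof -
  have c: "\<iota> (fls_const \<alpha>) ^ (q ^ k) = \<iota> (fls_const \<alpha>)" for k
    by (simp add: const_power_q flip: \<iota>_power fls_const_power)
  show ?thesis
    using assms by (induction rule: lin_induct) (auto simp: c poly_monom power_mult_distrib distrib_left)
qed

lemma poly_lin_0: "u \<in> LP \<Longrightarrow> poly u 0 = (0::'c)"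
  using poly_lin_add[of u 0 0] by (metis add.right_neutral add_left_cancel)

lemma poly_lin_diff:
  "u \<in> LP \<Longrightarrow> poly u (a - b) = poly u a - poly u (b::'c)"
  using poly_lin_add[of u "a - b" b] by simp

section \<open>Frobenius and its inverse on linear polynomials\<close>

text \<open>Frobenius moves the exponent \<open>q ^ k\<close> to \<open>q ^ Suc k\<close>, so it
  lands among the linear polynomials without linear term, where \<open>tau_inv\<close> is
  meaningful.\<close>

lemma lin_power_q:
  assumes "u \<in> LP"
  shows "u ^ q \<in> LP" "Polynomial.coeff (u ^ q) 1 = (0::'c)"
proof -
  have "u ^ q \<in> LP \<and> Polynomial.coeff (u ^ q) 1 = 0"
    using assms
  proof (induction rule: lin_induct)
    case (monom c k)
    have "Polynomial.monom (c ^ q) (q ^ Suc k) \<in> LP" by (rule lin_monom)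
    then show ?case using one_less_q by (simp add: monom_power mult.commute)
  next
    case (add u v)
    then show ?case using poly_add_power_q[of u v 1] by (simp add: lin_add)
  qed (use one_less_q in \<open>simp add: lin_0 zero_power\<close>)
  then show "u ^ q \<in> LP" "Polynomial.coeff (u ^ q) 1 = 0" by auto
qed

lemma tau_funpow: "(tau q ^^ n) u = u ^ (q ^ n)" for u :: "'c poly"
  by (induction n) (simp_all add: tau_def mult.commute flip: power_mult)

lemma lin_power_q_power: "u \<in> LP \<Longrightarrow> u ^ (q ^ n) \<in> LP" for u :: "'c poly"
proof (induction n)
  case (Suc n)
  then show ?case using lin_power_q(1)[of "u ^ (q ^ n)"] by (simp add: mult.commute flip: power_mult)
qed simp

lemma lin_tau_inv: "tau_inv q u \<in> LP" for u :: "'c poly"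
  unfolding tau_inv_def by (intro lin_sum lin_monom)

lemma tau_inv_power:
  assumes "u \<in> LP" "Polynomial.coeff u 1 = (0::'c)"
  shows "tau_inv q u ^ q = u"
proof -
  have "tau_inv q u ^ q = (\<Sum>k\<in>{1..Polynomial.degree u}.
      Polynomial.monom (qroot q (Polynomial.coeff u (q ^ k))) (q ^ (k - 1)) ^ q)"
    unfolding tau_inv_def using poly_sum_power_q[where k = 1] by simp
  also have "\<dots> = (\<Sum>k\<in>{1..Polynomial.degree u}. Polynomial.monom (Polynomial.coeff u (q ^ k)) (q ^ k))"
    by (intro sum.cong) (auto simp: monom_power qroot_power simp flip: power_Suc2)
  \<comment> \<open>The added index \<open>0\<close> carries the coefficient at
    \<open>q ^ 0 = 1\<close>, zero by hypothesis.\<close>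
  also have "\<dots> = (\<Sum>k\<in>{..Polynomial.degree u}. Polynomial.monom (Polynomial.coeff u (q ^ k)) (q ^ k))"
    using assms(2) by (intro sum.mono_neutral_left) (auto simp: not_le)
  also have "\<dots> = u" using lin_as_sum[OF assms(1)] by simp
  finally show ?thesis .
qed

text \<open>By injectivity of Frobenius on polynomials, \<open>tau_inv\<close> is computed by
  exhibiting any linear \<open>q\<close>-th root.\<close>

lemma tau_inv_eqI:
  assumes "v \<in> LP" "v ^ q = u"
  shows "tau_inv q u = (v :: 'c poly)"
proof -
  have "tau_inv q u ^ q = u"
    using lin_power_q[OF assms(1)] assms(2) by (intro tau_inv_power) auto
  then show ?thesis using assms(2) poly_qroot_unique by metis
qed

section \<open>Dilations, the operators \<open>\<Delta>\<^sup>(\<^sup>l\<^sup>)\<close> and their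
  series\<close>

lemma coeff_dilate: "Polynomial.coeff (dilate \<iota> a u) i = \<iota> a ^ i * Polynomial.coeff u i"
  unfolding dilate_def by (simp add: coeff_pcompose_linear)

lemma lin_dilate: "u \<in> LP \<Longrightarrow> dilate \<iota> a u \<in> LP"
  by (auto simp: lin_polys_def coeff_dilate)

lemma poly_dilate: "poly (dilate \<iota> a u) t = poly u (\<iota> a * t)"
  by (simp add: dilate_def poly_pcompose mult.commute)

lemma dilate_power: "dilate \<iota> a (u ^ n) = dilate \<iota> a u ^ n"
  by (induction n) (simp_all add: dilate_def pcompose_mult pcompose_1)

text \<open>The linear coefficient is multiplied by \<open>x - x = 0\<close>, so
  \<open>tau_inv\<close> really inverts Frobenius here.\<close>

lemma carlitz_d_power:
  assumes "u \<in> LP"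
  shows "carlitz_d q \<iota> u ^ q = Delta \<iota> u"
  unfolding carlitz_d_def
proof (rule tau_inv_power)
  show "Delta \<iota> u \<in> LP"
    unfolding Delta_def using assms by (intro lin_diff lin_dilate lin_smult)
  show "Polynomial.coeff (Delta \<iota> u) 1 = 0"
    by (simp add: Delta_def coeff_dilate)
qed

lemma lin_carlitz_d_funpow: "u \<in> LP \<Longrightarrow> (carlitz_d q \<iota> ^^ l) u \<in> LP"
  by (cases l) (auto simp: carlitz_d_def lin_tau_inv)

lemma Delta_pow_0: "Delta_pow q \<iota> 0 u = u"
  by (simp add: Delta_pow_def divided_power_def)

lemma lin_Delta_pow: "u \<in> LP \<Longrightarrow> Delta_pow q \<iota> l u \<in> LP"
  by (simp add: Delta_pow_def divided_power_def tau_funpow lin_power_q_power lin_carlitz_d_funpow)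

text \<open>With \<open>v\<close> the \<open>l\<close>-fold Carlitz derivative of \<open>u\<close>,
  one Frobenius removes the root in the outermost derivative; the remaining \<open>l\<close> act on
  \<open>v(xt) - x v(t)\<close> and raise the scalar \<open>x\<close> to \<open>x^(q^l)\<close>. The
  recursion is free of roots.\<close>

lemma Delta_pow_Suc:
  assumes "u \<in> LP"
  shows "Delta_pow q \<iota> (Suc l) u =
    dilate \<iota> fls_X (Delta_pow q \<iota> l u) - Polynomial.smult (\<iota> fls_X ^ (q ^ l)) (Delta_pow q \<iota> l u)"
proof -
  define v where "v = (carlitz_d q \<iota> ^^ l) u"
  have "Delta_pow q \<iota> (Suc l) u = carlitz_d q \<iota> v ^ (q * q ^ l)"
    by (simp add: Delta_pow_def divided_power_def v_def tau_funpow del: funpow.simps)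
       (simp add: v_def)
  also have "\<dots> = Delta \<iota> v ^ (q ^ l)"
    using lin_carlitz_d_funpow[OF assms] by (simp add: power_mult carlitz_d_power v_def)
  also have "\<dots> = dilate \<iota> fls_X (v ^ (q ^ l)) - Polynomial.smult (\<iota> fls_X ^ (q ^ l)) (v ^ (q ^ l))"
    by (simp add: Delta_def poly_diff_power_q dilate_power smult_power)
  finally show ?thesis by (simp add: Delta_pow_def divided_power_def v_def tau_funpow)
qed

text \<open>The operators are diagonal. At \<open>i = q ^ n\<close> with \<open>l \<le> n\<close>
  the product is the quotient of \<open>D_n\<close> by the \<open>q ^ l\<close>-th power of
  \<open>D_(n-l)\<close>.\<close>

lemma coeff_Delta_pow:
  assumes "u \<in> LP"
  shows "Polynomial.coeff (Delta_pow q \<iota> l u) i =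
    (\<Prod>m<l. \<iota> fls_X ^ i - \<iota> fls_X ^ (q ^ m)) * Polynomial.coeff u i"
  by (induction l) (simp_all add: Delta_pow_0 Delta_pow_Suc[OF assms] coeff_dilate algebra_simps)

text \<open>For \<open>k < l\<close> the factor \<open>m = k\<close> of the eigenvalue at
  \<open>q ^ k\<close> vanishes, and higher exponents do not occur in \<open>u\<close>.\<close>

lemma Delta_pow_eq_0:
  assumes "u \<in> LP" "Polynomial.degree u < q ^ l"
  shows "Delta_pow q \<iota> l u = 0"
proof (rule poly_eqI_lin)
  fix k show "Polynomial.coeff (Delta_pow q \<iota> l u) (q ^ k) = Polynomial.coeff 0 (q ^ k)"
  proof (cases "k < l")
    case True
    then have "(\<Prod>m<l. \<iota> fls_X ^ (q ^ k) - \<iota> fls_X ^ (q ^ m)) = 0"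
      by (intro prod_zero) auto
    then show ?thesis by (simp add: coeff_Delta_pow[OF assms(1)])
  next
    case False
    then have "q ^ l \<le> q ^ k" using one_less_q by simp
    then have "Polynomial.coeff u (q ^ k) = 0" using assms(2) by (intro coeff_eq_0) simp
    then show ?thesis by (simp add: coeff_Delta_pow[OF assms(1)])
  qed
qed (auto intro: lin_Delta_pow assms lin_0)

text \<open>Replaces an index set depending on \<open>u\<close> by a common range, so that values at
  several polynomials can be compared termwise.\<close>

lemma Delta_series_eq:
  assumes "u \<in> LP" "Polynomial.degree u < q ^ Suc n"
  shows "Delta_series q \<iota> \<sigma> u = (\<Sum>l\<in>{1..n}. Polynomial.smult (\<sigma> l) (Delta_pow q \<iota> l u))"
  unfolding Delta_series_def
proof (rule sum.mono_neutral_left)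
  show "{l. 1 \<le> l \<and> Delta_pow q \<iota> l u \<noteq> 0} \<subseteq> {1..n}"
  proof clarify
    fix l assume "1 \<le> l" "Delta_pow q \<iota> l u \<noteq> 0"
    then have "\<not> q ^ Suc n \<le> q ^ l"
      using Delta_pow_eq_0[OF assms(1)] assms(2) by (meson less_le_trans)
    then have "\<not> Suc n \<le> l" using one_less_q by (meson power_increasing less_imp_le)
    then show "l \<in> {1..n}" using \<open>1 \<le> l\<close> by simp
  qed
qed auto

lemma degree_less_q_power: "Polynomial.degree u \<le> n \<Longrightarrow> Polynomial.degree u < q ^ Suc n"
  using less_q_power[of "Suc n"] by simp

lemma lin_Delta_series: "u \<in> LP \<Longrightarrow> Delta_series q \<iota> \<sigma> u \<in> LP"
  unfolding Delta_series_def by (intro lin_sum lin_smult lin_Delta_pow)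

text \<open>For \<open>l \<ge> 1\<close> the factor \<open>m = 0\<close> is \<open>x - x\<close>.
  This makes \<open>tau_inv\<close> applicable to the series.\<close>

lemma coeff_Delta_series_1: 
  assumes "u \<in> LP"
  shows "Polynomial.coeff (Delta_series q \<iota> \<sigma> u) 1 = 0"
proof -
  have "Polynomial.coeff (Delta_pow q \<iota> l u) 1 = 0" if "1 \<le> l" for l
  proof -
    have "(\<Prod>m<l. \<iota> fls_X ^ 1 - \<iota> fls_X ^ (q ^ m)) = 0"
      using that by (intro prod_zero) (auto intro!: bexI[of _ 0])
    then show ?thesis by (simp add: coeff_Delta_pow[OF assms])
  qed
  then show ?thesis unfolding Delta_series_def coeff_sum by (intro sum.neutral) simp
qed

lemma Delta_pow_add:
  assumes "u \<in> LP" "v \<in> LP"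
  shows "Delta_pow q \<iota> l (u + v) = Delta_pow q \<iota> l u + Delta_pow q \<iota> l v"
  by (rule poly_eqI) (simp add: coeff_Delta_pow assms lin_add algebra_simps)

lemma Delta_pow_smult:
  assumes "u \<in> LP"
  shows "Delta_pow q \<iota> l (Polynomial.smult c u) = Polynomial.smult c (Delta_pow q \<iota> l u)"
  by (rule poly_eqI) (simp add: coeff_Delta_pow assms lin_smult algebra_simps)

lemma Delta_series_add:
  assumes "u \<in> LP" "v \<in> LP"
  shows "Delta_series q \<iota> \<sigma> (u + v) = Delta_series q \<iota> \<sigma> u + Delta_series q \<iota> \<sigma> v"
proof -
  define n where "n = max (Polynomial.degree u) (Polynomial.degree v)"
  have "Polynomial.degree (u + v) \<le> n" by (simp add: n_def degree_add_le)
  moreover have "Polynomial.degree u \<le> n" "Polynomial.degree v \<le> n" by (auto simp: n_def)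
  ultimately show ?thesis
    using assms by (simp add: Delta_series_eq[of _ n] degree_less_q_power lin_add Delta_pow_add
      smult_add_right sum.distrib del: power_Suc)
qed

lemma Delta_series_smult:
  assumes "u \<in> LP"
  shows "Delta_series q \<iota> \<sigma> (Polynomial.smult c u) = Polynomial.smult c (Delta_series q \<iota> \<sigma> u)"
proof -
  define n where "n = Polynomial.degree u"
  have "Polynomial.degree (Polynomial.smult c u) < q ^ Suc n" "Polynomial.degree u < q ^ Suc n"
    by (auto simp only: n_def intro!: degree_less_q_power degree_smult_le)
  then show ?thesis
    by (intro poly_eqI, subst (1 2) Delta_series_eq[of _ n])
      (simp_all add: assms lin_smult Delta_pow_smult coeff_sum sum_distrib_left mult_ac)
qed

section \<open>Sup-norm bounds and continuous linear functions\<close>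

lemma fls_abs_nonneg [simp]: "0 \<le> fls_abs (z :: 'k fls)"
  by (simp add: fls_abs_def)

abbreviation ev :: "'c poly \<Rightarrow> 'k fls \<Rightarrow> 'c" where
  "ev u \<equiv> \<lambda>t. poly u (\<iota> t)"

text \<open>A predicate instead of a supremum: bounds can be combined before the supremum is known
  to be finite.\<close>

definition bounded_by :: "('k fls \<Rightarrow> 'c) \<Rightarrow> real \<Rightarrow> bool" where
  "bounded_by f B \<longleftrightarrow> (\<forall>t\<in>int_ring. vabs (f t) \<le> B)"

lemma bounded_byI: "(\<And>t. t \<in> int_ring \<Longrightarrow> vabs (f t) \<le> B) \<Longrightarrow> bounded_by f B"
  and bounded_byD: "bounded_by f B \<Longrightarrow> t \<in> int_ring \<Longrightarrow> vabs (f t) \<le> B"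
  by (auto simp: bounded_by_def)

lemma bounded_by_nonneg: "bounded_by f B \<Longrightarrow> 0 \<le> B"
  using bounded_byD[OF _ int_ring_0, of f B] by (meson order_trans vabs_nonneg)

lemma bounded_by_diff: "bounded_by f B \<Longrightarrow> bounded_by g B \<Longrightarrow> bounded_by (\<lambda>t. f t - g t) B"
  unfolding bounded_by_def by (blast intro: vabs_diff_le)

lemma vabs_X_power_le: "0 < n \<Longrightarrow> vabs (\<iota> fls_X ^ n) \<le> 1 / q"
  using one_less_q power_decreasing[of 1 n "1 / real q"] by (simp add: vabs_power vabs_X)

text \<open>There is no constant term and \<open>|t| \<le> 1\<close>, so every
  \<open>|t|^(q^k)\<close> is at most \<open>|t|\<close>. With additivity this one estimate gives
  boundedness and continuity.\<close>

lemma ev_lipschitz: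
  assumes "u \<in> LP"
  obtains C where "0 \<le> C" "\<And>t. t \<in> int_ring \<Longrightarrow> vabs (ev u t) \<le> C * fls_abs t"
proof
  define C where "C = (\<Sum>i\<le>Polynomial.degree u. vabs (Polynomial.coeff u i))"
  show C0: "0 \<le> C" unfolding C_def by (intro sum_nonneg) simp
  fix t :: "'k fls" assume t: "t \<in> int_ring"
  show "vabs (ev u t) \<le> C * fls_abs t"
    unfolding poly_altdef
  proof (rule vabs_sum_le)
    show "0 \<le> C * fls_abs t" using C0 by simp
    fix i assume i: "i \<in> {..Polynomial.degree u}"
    show "vabs (Polynomial.coeff u i * \<iota> t ^ i) \<le> C * fls_abs t"
    proof (cases "Polynomial.coeff u i = 0")
      case True
      then show ?thesis using C0 by simp
    next
      case False
      then obtain k where "i = q ^ k" using assms by (auto simp: lin_polys_def)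
      then have "1 \<le> i" using one_less_q by simp
      then have "vabs (\<iota> t) ^ i \<le> vabs (\<iota> t) ^ 1"
        using t by (intro power_decreasing) (auto simp: vabs_le_1)
      moreover have "vabs (Polynomial.coeff u i) \<le> C"
        unfolding C_def using i by (intro member_le_sum) auto
      ultimately show ?thesis
        using C0 by (simp add: vabs_mult vabs_power vabs_\<iota> mult_mono)
    qed
  qed
qed

lemma ev_bounded:
  assumes "u \<in> LP"
  obtains B where "bounded_by (ev u) B"
proof -
  obtain C where C: "0 \<le> C" "\<And>t. t \<in> int_ring \<Longrightarrow> vabs (ev u t) \<le> C * fls_abs t"
    using ev_lipschitz[OF assms] by blast
  have "bounded_by (ev u) C"
  proof (rule bounded_byI)
    fix t :: "'k fls" assume "t \<in> int_ring"
    then have "C * fls_abs t \<le> C * 1" using C(1) by (intro mult_left_mono) (auto simp: int_ring_def)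
    with C(2)[OF \<open>t \<in> int_ring\<close>] show "vabs (ev u t) \<le> C" by simp
  qed
  then show ?thesis by (rule that)
qed

lemma ev_Delta_pow_Suc:
  assumes "u \<in> LP"
  shows "ev (Delta_pow q \<iota> (Suc l) u) t =
    ev (Delta_pow q \<iota> l u) (fls_X * t) - \<iota> fls_X ^ (q ^ l) * ev (Delta_pow q \<iota> l u) t"
  by (simp add: Delta_pow_Suc[OF assms] poly_dilate \<iota>_mult)

lemma int_ring_X_mult: "t \<in> int_ring \<Longrightarrow> fls_X * t \<in> int_ring"
  "t \<in> int_ring \<Longrightarrow> fls_X ^ n * t \<in> int_ring"
  using int_ring_mult[OF int_ring_X_power] by (metis power_one_right, blast)

lemma vabs_X_power_mult_le: "vabs y \<le> B \<Longrightarrow> vabs (\<iota> fls_X ^ (q ^ l) * y) \<le> B / q"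
  using mult_mono[OF vabs_X_power_le[of "q ^ l"], of "vabs y" B] one_less_q by (simp add: vabs_mult)

lemma divide_q_le: "0 \<le> B \<Longrightarrow> B / q \<le> B"
  using one_less_q by (simp add: divide_le_eq mult_le_cancel_left1)

text \<open>In the recursion \<open>xt\<close> stays in the ring of integers and
  \<open>|x^(q^l)| < 1\<close>, so neither term exceeds \<open>B\<close>.\<close>

lemma bounded_by_Delta_pow:
  assumes "u \<in> LP" "bounded_by (ev u) B"
  shows "bounded_by (ev (Delta_pow q \<iota> l u)) B"
proof (induction l)
  case (Suc l)
  show ?case
  proof (rule bounded_byI)
    fix t :: "'k fls" assume "t \<in> int_ring"
    then show "vabs (ev (Delta_pow q \<iota> (Suc l) u) t) \<le> B"
      unfolding ev_Delta_pow_Suc[OF assms(1)]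
      using bounded_by_nonneg[OF assms(2)]
      by (intro vabs_diff_le order_trans[OF vabs_X_power_mult_le divide_q_le])
        (auto intro: bounded_byD[OF Suc] int_ring_X_mult)
  qed
qed (simp add: Delta_pow_0 assms(2))

text \<open>Up to terms of relative size \<open>1/q\<close>, \<open>\<Delta>\<^sup>(\<^sup>l\<^sup>)\<close> is the shift \<open>u(t) \<mapsto> u(x\<^sup>l t)\<close>.\<close>

lemma Delta_pow_approx:
  assumes "u \<in> LP" "bounded_by (ev u) B" "t \<in> int_ring"
  shows "vabs (ev (Delta_pow q \<iota> l u) t - ev u (fls_X ^ l * t)) \<le> B / q"
  using assms(3)
proof (induction l arbitrary: t)
  case 0
  then show ?case using bounded_by_nonneg[OF assms(2)] by (simp add: Delta_pow_0)
next
  case (Suc l)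
  \<comment> \<open>The induction hypothesis is used at \<open>fls_X * t\<close>; by the ultrametric
    inequality the new error does not add to the old one.\<close>
  have "vabs (ev (Delta_pow q \<iota> l u) (fls_X * t) - ev u (fls_X ^ l * (fls_X * t))) \<le> B / q"
    using Suc by (intro Suc.IH int_ring_X_mult)
  moreover have "vabs (\<iota> fls_X ^ (q ^ l) * ev (Delta_pow q \<iota> l u) t) \<le> B / q"
    using Suc.prems by (intro vabs_X_power_mult_le bounded_byD[OF bounded_by_Delta_pow[OF assms(1,2)]])
  ultimately have "vabs (ev (Delta_pow q \<iota> l u) (fls_X * t) - ev u (fls_X ^ l * (fls_X * t)) -
      \<iota> fls_X ^ (q ^ l) * ev (Delta_pow q \<iota> l u) t) \<le> B / q"
    by (rule vabs_diff_le)
  moreover have "fls_X ^ l * (fls_X * t) = fls_X ^ Suc l * t"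
    by (simp add: mult_ac)
  ultimately show ?case
    by (simp only: ev_Delta_pow_Suc[OF assms(1)]) (simp add: algebra_simps)
qed

lemma vabs_unit_mult_le: "vabs a \<le> 1 \<Longrightarrow> vabs y \<le> B \<Longrightarrow> vabs (a * y) \<le> B" for a y :: 'c
  using mult_mono[of "vabs a" 1 "vabs y" B] by (simp add: vabs_mult)

lemma bounded_by_Delta_series:
  assumes "u \<in> LP" "bounded_by (ev u) B" "\<And>l. 1 \<le> l \<Longrightarrow> vabs (\<sigma> l) \<le> 1"
  shows "bounded_by (ev (Delta_series q \<iota> \<sigma> u)) B"
proof (rule bounded_byI)
  fix t :: "'k fls" assume t: "t \<in> int_ring"
  show "vabs (ev (Delta_series q \<iota> \<sigma> u) t) \<le> B"
    unfolding Delta_series_def poly_sum poly_smult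
    using bounded_by_nonneg[OF assms(2)]
    by (intro vabs_sum_le vabs_unit_mult_le assms(3) bounded_byD[OF bounded_by_Delta_pow[OF assms(1,2)] t])
      auto
qed

text \<open>Termwise from \<open>Delta_pow_approx\<close>, since coefficients of modulus at most 1
  and summation do not enlarge an ultrametric error.\<close>

lemma Delta_series_approx:
  assumes "u \<in> LP" "bounded_by (ev u) B" "\<And>l. 1 \<le> l \<Longrightarrow> vabs (\<sigma> l) \<le> 1" "t \<in> int_ring"
    and n: "Polynomial.degree u \<le> n"
  shows "vabs (ev (Delta_series q \<iota> \<sigma> u) t - (\<Sum>l\<in>{1..n}. \<sigma> l * ev u (fls_X ^ l * t))) \<le> B / q"
proof -
  have "ev (Delta_series q \<iota> \<sigma> u) t - (\<Sum>l\<in>{1..n}. \<sigma> l * ev u (fls_X ^ l * t)) =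
      (\<Sum>l\<in>{1..n}. \<sigma> l * (ev (Delta_pow q \<iota> l u) t - ev u (fls_X ^ l * t)))"
    by (simp add: Delta_series_eq[OF assms(1) degree_less_q_power[OF n]] poly_sum
      right_diff_distrib sum_subtractf)
  also have "vabs \<dots> \<le> B / q"
    using bounded_by_nonneg[OF assms(2)] assms
    by (intro vabs_sum_le vabs_unit_mult_le Delta_pow_approx) auto
  finally show ?thesis .
qed

section \<open>Continuous linear functions and their values at powers of x\<close>

lemma C0D: "f \<in> C0 \<iota> \<Longrightarrow> s \<in> int_ring \<Longrightarrow> t \<in> int_ring \<Longrightarrow> f (s + t) = f s + f t"
  "f \<in> C0 \<iota> \<Longrightarrow> t \<in> int_ring \<Longrightarrow> f (fls_const \<alpha> * t) = \<iota> (fls_const \<alpha>) * f t"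
  by (auto simp: C0_def)

lemma C0_0: "f \<in> C0 \<iota> \<Longrightarrow> f 0 = 0"
  using C0D(1)[of f 0 0] int_ring_0 by (metis add.right_neutral add_left_cancel)

lemma dist_fls_diff: "dist s t = dist (s - t) (0 :: 'k fls)"
  by (simp add: dist_fls_def)

text \<open>Continuity at 0, restated through vanishing coefficients so that it applies to high
  powers of \<open>x\<close> and to remainders of expansions.\<close>

lemma C0_small:
  assumes "f \<in> C0 \<iota>" "0 < e"
  obtains n where "\<And>z. (\<forall>k\<le>int n. fls_nth z k = 0) \<Longrightarrow> vabs (f z) < e"
proof -
  have "continuous_on int_ring f" using assms by (simp add: C0_def)
  then obtain d where d: "0 < d" "\<And>z. z \<in> int_ring \<Longrightarrow> dist z 0 < d \<Longrightarrow> dist (f z) (f 0) < e"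
    using assms(2) int_ring_0 unfolding continuous_on_iff by metis
  obtain n where n: "inverse 2 ^ n < d"
    using real_arch_pow_inv[OF d(1), of "inverse 2"] by auto
  show thesis
  proof (rule that)
    fix z :: "'k fls" assume z: "\<forall>k\<le>int n. fls_nth z k = 0"
    then have "dist z 0 < inverse 2 ^ n" by (simp only: dist_0_fls_less power_inverse)
    with n have "dist z 0 < d" by (rule order.strict_trans[rotated])
    moreover have "z \<in> int_ring" using z by (auto simp: int_ring_iff)
    ultimately show "vabs (f z) < e"
      using d(2)[of z] by (simp add: dist_vabs C0_0[OF assms(1)])
  qed
qed

lemma C0_X_power_small:
  assumes "f \<in> C0 \<iota>" "0 < e"
  obtains n where "\<And>j. n \<le> j \<Longrightarrow> vabs (f (fls_X ^ j)) < e"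
proof -
  obtain n where n: "\<And>z. (\<forall>k\<le>int n. fls_nth z k = 0) \<Longrightarrow> vabs (f z) < e"
    using C0_small[OF assms] by blast
  have "vabs (f (fls_X ^ j)) < e" if "Suc n \<le> j" for j
    using that by (intro n) auto
  then show thesis by (rule that)
qed

lemma ev_C0:
  assumes "u \<in> LP"
  shows "ev u \<in> C0 \<iota>"
proof -
  obtain C where C: "0 \<le> C" "\<And>t. t \<in> int_ring \<Longrightarrow> vabs (ev u t) \<le> C * fls_abs t"
    using ev_lipschitz[OF assms] by blast
  have "continuous_on int_ring (ev u)"
    unfolding continuous_on_iff
  proof (intro ballI allI impI)
    fix s :: "'k fls" and e :: real
    assume s: "s \<in> int_ring" and e: "0 < e"
    \<comment> \<open>\<open>C + 1\<close> keeps the denominator positive. The library ball of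
      radius \<open>2^(-n)\<close> lies in the ball of radius \<open>q^(-n)\<close> for
      \<open>fls_abs\<close>.\<close>
    then obtain n where n: "(1 / real q) ^ n < e / (C + 1)"
      using real_arch_pow_inv[of "e / (C + 1)" "1 / real q"] C(1) one_less_q by auto
    show "\<exists>d>0. \<forall>t\<in>int_ring. dist t s < d \<longrightarrow> dist (ev u t) (ev u s) < e"
    proof (intro exI conjI ballI impI)
      show "0 < inverse (2 ^ n :: real)" by simp
      fix t assume t: "t \<in> int_ring" "dist t s < inverse (2 ^ n)"
      then have "\<forall>k<int n. fls_nth (t - s) k = 0"
        unfolding dist_fls_diff[of t s] dist_0_fls_less by simp
      then have "fls_abs (t - s) \<le> real CARD('k) powi (- int n)"
        by (simp only: fls_abs_le_iff)
      also have "\<dots> = (1 / real q) ^ n"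
        by (simp add: card_k power_int_minus power_one_over inverse_eq_divide)
      also note n
      finally have "(C + 1) * fls_abs (t - s) < e"
        using C(1) by (simp add: field_simps)
      moreover have "C * fls_abs (t - s) \<le> (C + 1) * fls_abs (t - s)"
        by (intro mult_right_mono) auto
      moreover have "vabs (ev u t - ev u s) \<le> C * fls_abs (t - s)"
        using C(2)[OF int_ring_diff[OF t(1) s]] by (simp add: \<iota>_diff poly_lin_diff[OF assms])
      ultimately show "dist (ev u t) (ev u s) < e" by (simp add: dist_vabs)
    qed
  qed
  then show ?thesis
    using poly_lin_add[OF assms] poly_lin_const[OF assms] by (simp add: C0_def \<iota>_add \<iota>_mult)
qed

lemma C0_diff:
  assumes "f \<in> C0 \<iota>" "g \<in> C0 \<iota>"
  shows "(\<lambda>t. f t - g t) \<in> C0 \<iota>"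
proof -
  have "continuous_on int_ring (\<lambda>t. f t - g t)"
    unfolding continuous_on_iff
  proof (intro ballI allI impI)
    fix s :: "'k fls" and e :: real
    assume s: "s \<in> int_ring" and e: "0 < e"
    have "continuous_on int_ring f" "continuous_on int_ring g" using assms by (auto simp: C0_def)
    then obtain d1 d2 where d: "0 < d1" "\<And>t. t \<in> int_ring \<Longrightarrow> dist t s < d1 \<Longrightarrow> vabs (f t - f s) < e"
      "0 < d2" "\<And>t. t \<in> int_ring \<Longrightarrow> dist t s < d2 \<Longrightarrow> vabs (g t - g s) < e"
      using s e unfolding continuous_on_iff dist_vabs by metis
    show "\<exists>d>0. \<forall>t\<in>int_ring. dist t s < d \<longrightarrow> dist (f t - g t) (f s - g s) < e"
    proof (intro exI conjI ballI impI)
      show "0 < min d1 d2" using d by simp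
      fix t assume "t \<in> int_ring" "dist t s < min d1 d2"
      then have "vabs ((f t - f s) - (g t - g s)) < e" using d by (auto intro!: vabs_diff_less[of "f t - f s" _ "g t - g s"])
      then show "dist (f t - g t) (f s - g s) < e" by (simp add: dist_vabs algebra_simps)
    qed
  qed
  then show ?thesis using assms by (simp add: C0_def algebra_simps)
qed

text \<open>Truncations \<open>T n\<close> of \<open>t\<close> are combinations of powers of
  \<open>x\<close> with constants of modulus at most 1, so \<open>f\<close> is at most
  \<open>B\<close> there; the remainder is controlled by continuity at 0.\<close>

lemma C0_bounded_by:
  assumes f: "f \<in> C0 \<iota>" and B: "\<And>j. vabs (f (fls_X ^ j)) \<le> B"
  shows "bounded_by f B"
proof (rule bounded_byI, rule ccontr)
  fix t :: "'k fls" assume t: "t \<in> int_ring" and "\<not> vabs (f t) \<le> B"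
  then have less: "B < vabs (f t)" by simp
  have B0: "0 \<le> B" using B[of 0] vabs_nonneg order_trans by blast
  define T where "T n = (\<Sum>i<n. fls_const (fls_nth t (int i)) * fls_X ^ i)" for n
  have T: "T n \<in> int_ring \<and> vabs (f (T n)) \<le> B" for n
  proof (induction n)
    case (Suc n)
    have m: "fls_const (fls_nth t (int n)) * fls_X ^ n \<in> int_ring"
      by (intro int_ring_mult int_ring_const int_ring_X_power)
    have "vabs (\<iota> (fls_const (fls_nth t (int n))) * f (fls_X ^ n)) \<le> B"
      by (intro vabs_unit_mult_le B vabs_le_1 int_ring_const)
    then have "vabs (f (fls_const (fls_nth t (int n)) * fls_X ^ n)) \<le> B"
      by (simp add: C0D(2)[OF f] int_ring_X_power)
    then show ?case using Suc m by (simp add: T_def C0D(1)[OF f] vabs_add_le int_ring_add)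
  qed (simp add: T_def int_ring_0 C0_0[OF f] B0)
  have T_nth: "fls_nth (T n) k = (if 0 \<le> k \<and> k < int n then fls_nth t k else 0)" for n k
    by (induction n) (auto simp: T_def)
  \<comment> \<open>A remainder value merely smaller than \<open>vabs (f t)\<close> suffices: both
    summands of \<open>f t\<close> are then strictly smaller than \<open>f t\<close>.\<close>
  obtain n where n: "\<And>z. (\<forall>k\<le>int n. fls_nth z k = 0) \<Longrightarrow> vabs (f z) < vabs (f t)"
    using C0_small[OF f, of "vabs (f t)"] less B0 by force
  have "vabs (f (t - T (Suc n))) < vabs (f t)"
    using t by (intro n) (auto simp: T_nth int_ring_iff)
  moreover have "vabs (f (T (Suc n))) < vabs (f t)" using T less by (meson order_le_less_trans)
  ultimately have "vabs (f (t - T (Suc n)) + f (T (Suc n))) < vabs (f t)"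
    using vabs_add[of "f (t - T (Suc n))" "f (T (Suc n))"] by simp
  then show False
    using C0D(1)[OF f int_ring_diff[OF t], of "T (Suc n)" "T (Suc n)"] T[of "Suc n"] by simp
qed

lemma C0_bounded:
  assumes f: "f \<in> C0 \<iota>"
  obtains B where "bounded_by f B"
proof -
  obtain n where n: "\<And>j. n \<le> j \<Longrightarrow> vabs (f (fls_X ^ j)) < 1"
    using C0_X_power_small[OF f, of 1] by auto
  \<comment> \<open>The \<open>1\<close> covers the tail \<open>n \<le> j\<close>, the sum each
    earlier index.\<close>
  define B where "B = 1 + (\<Sum>j<n. vabs (f (fls_X ^ j)))"
  have "vabs (f (fls_X ^ j)) \<le> B" for j
  proof (cases "n \<le> j")
    case True
    then show ?thesis using n[OF True] sum_nonneg[of "{..<n}" "\<lambda>j. vabs (f (fls_X ^ j))"]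
      by (simp add: B_def)
  next
    case False
    then show ?thesis
      using member_le_sum[of j "{..<n}" "\<lambda>j. vabs (f (fls_X ^ j))"] by (simp add: B_def)
  qed
  then show ?thesis using C0_bounded_by[OF f] that by blast
qed

end

section \<open>The polynomials \<open>Q n\<close>\<close>

locale delta_basis = completed_closure p \<nu> q \<iota>
  for p \<nu> q :: nat and \<iota> :: "'k::{field,finite} fls \<Rightarrow> 'c::{field,complete_space}" +
  fixes \<sigma> :: "nat \<Rightarrow> 'c" and \<delta> :: "'c poly \<Rightarrow> 'c poly" and P Q :: "nat \<Rightarrow> 'c poly"
  assumes vabs_\<sigma>_1: "vabs (\<sigma> 1) = 1" and vabs_\<sigma>_ge_2: "2 \<le> l \<Longrightarrow> vabs (\<sigma> l) \<le> 1"
    and \<delta>_eq: "\<delta> = tau_inv q \<circ> Delta_series q \<iota> \<sigma>"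
    and basic_P: "basic_sequence q \<iota> \<delta> P"
    and Q_eq: "Q n = Polynomial.smult (inverse (\<iota> (carlitz_D q n))) (P n)"
begin

section \<open>The relations between the delta operator and the normalised basic sequence\<close>

abbreviation S :: "'c poly \<Rightarrow> 'c poly" where
  "S \<equiv> Delta_series q \<iota> \<sigma>"

lemma vabs_\<sigma>: "1 \<le> l \<Longrightarrow> vabs (\<sigma> l) \<le> 1"
  using vabs_\<sigma>_1 vabs_\<sigma>_ge_2[of l] by (cases "l = 1") auto

text \<open>Trades the semilinear \<open>\<delta>\<close> for the linear \<open>S\<close>; facts
  about \<open>\<delta>\<close> are proved for \<open>S\<close> and pulled back by uniqueness of
  roots.\<close>

lemma \<delta>_power: "u \<in> LP \<Longrightarrow> \<delta> u ^ q = S u"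
  using tau_inv_power[OF lin_Delta_series coeff_Delta_series_1] by (simp add: \<delta>_eq)

lemma lin_\<delta>: "\<delta> u \<in> LP"
  by (simp add: \<delta>_eq lin_tau_inv)

lemma \<delta>_eqI: "v \<in> LP \<Longrightarrow> v ^ q = S u \<Longrightarrow> \<delta> u = v"
  by (simp add: \<delta>_eq tau_inv_eqI)

lemma lin_P: "P n \<in> LP" and degree_P: "Polynomial.degree (P n) = q ^ n"
  and P_0_at_1: "poly (P 0) 1 = 1" and P_at_1: "1 \<le> n \<Longrightarrow> poly (P n) 1 = 0"
  and \<delta>_P_0: "\<delta> (P 0) = 0"
  and \<delta>_P: "\<delta> (P (Suc n)) = Polynomial.smult (qroot q (\<iota> (bracket q (Suc n)))) (P n)"
  using basic_P unfolding basic_sequence_def by (auto simp: Suc_le_eq dest: spec[of _ "Suc n"])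

text \<open>As \<open>q ^ Suc n \<noteq> 1\<close>, the coefficient at index 1 is
  \<open>-1\<close>.\<close>

lemma bracket_nonzero: "bracket q (Suc n) \<noteq> (0 :: 'k fls)"
proof -
  have "1 < q ^ Suc n" using one_less_q by (intro one_less_power) auto
  then have "int (q ^ Suc n) \<noteq> 1" by linarith
  then have "fls_nth (bracket q (Suc n) :: 'k fls) 1 \<noteq> 0"
    unfolding bracket_def by (simp only: fls_minus_nth fls_X_power_nth fls_X_nth) simp
  then show ?thesis by auto
qed

lemma carlitz_D_Suc: "carlitz_D q (Suc n) = bracket q (Suc n) * (carlitz_D q n :: 'k fls) ^ q"
proof -
  have "(\<Prod>j\<in>{1..n}. bracket q j ^ q ^ (Suc n - j)) = (\<Prod>j\<in>{1..n}. (bracket q j ^ q ^ (n - j) :: 'k fls) ^ q)"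
    by (intro prod.cong) (auto simp: Suc_diff_le mult.commute simp flip: power_mult)
  then show ?thesis by (simp add: carlitz_D_def prod_power_distrib mult.commute)
qed

lemma carlitz_D_nonzero: "carlitz_D q n \<noteq> (0 :: 'k fls)"
  by (induction n) (simp_all add: carlitz_D_Suc bracket_nonzero, simp add: carlitz_D_def)

lemma lin_Q: "Q n \<in> LP"
  by (simp add: Q_eq lin_smult lin_P)

lemma degree_Q: "Polynomial.degree (Q n) = q ^ n"
  by (simp add: Q_eq degree_P \<iota>_eq_0_iff carlitz_D_nonzero)

lemma Q_0_eq_P_0: "Q 0 = P 0"
  by (simp add: Q_eq carlitz_D_def \<iota>_1)

text \<open>The normalisation is made for this: the factor \<open>[n+1]\<close> coming from
  \<open>P\<close> is cancelled by the recursion \<open>carlitz_D_Suc\<close>.\<close>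

lemma S_Q_Suc: "S (Q (Suc n)) = Q n ^ q"
proof -
  have "S (P (Suc n)) = Polynomial.smult (\<iota> (bracket q (Suc n))) (P n ^ q)"
    by (simp add: \<delta>_P smult_power qroot_power flip: \<delta>_power[OF lin_P])
  moreover have cancel: "inverse (\<iota> (bracket q (Suc n))) * y * \<iota> (bracket q (Suc n)) = y" for y
    using bracket_nonzero[of n] by (simp add: \<iota>_eq_0_iff)
  ultimately show ?thesis
    by (simp add: Q_eq Delta_series_smult[OF lin_P] smult_power carlitz_D_Suc \<iota>_mult \<iota>_power
      power_inverse cancel)
qed

lemma \<delta>_Q_Suc: "\<delta> (Q (Suc n)) = Q n"
  by (rule \<delta>_eqI) (simp_all add: lin_Q S_Q_Suc)

lemma \<delta>_Q_0: "\<delta> (Q 0) = 0"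
  by (simp add: Q_0_eq_P_0 \<delta>_P_0)

lemma Q_at_1: "poly (Q n) 1 = (if n = 0 then 1 else 0)"
  using P_at_1[of n] by (cases n) (auto simp: Q_0_eq_P_0 P_0_at_1, simp add: Q_eq)

text \<open>A linear polynomial of degree 1 is a multiple of \<open>t\<close>, and the value at 1
  fixes the multiple.\<close>

lemma Q_0: "poly (Q 0) t = t"
proof -
  have "P 0 = (\<Sum>k\<in>{..1}. Polynomial.monom (Polynomial.coeff (P 0) (q ^ k)) (q ^ k))"
    using lin_as_sum[OF lin_P[of 0]] by (simp add: degree_P)
  also have "\<dots> = Polynomial.monom (Polynomial.coeff (P 0) 1) 1"
    using one_less_q by (simp add: coeff_eq_0 degree_P)
  finally have *: "P 0 = Polynomial.monom (Polynomial.coeff (P 0) 1) 1" .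
  then have "poly (P 0) 1 = Polynomial.coeff (P 0) 1" by (metis poly_monom mult.right_neutral power_one)
  then have "P 0 = Polynomial.monom 1 1" using * P_0_at_1 by simp
  then show ?thesis by (simp add: Q_0_eq_P_0 poly_monom)
qed

section \<open>Size of the basis polynomials at powers of x\<close>

text \<open>\<open>\<Delta>\<^sup>(\<^sup>j\<^sup>) u\<close> vanishes by degree, so the shift
  approximation at \<open>t = 1\<close> leaves only its error.\<close>

lemma ev_X_power_tail:
  assumes "u \<in> LP" "bounded_by (ev u) B" "Polynomial.degree u < q ^ j"
  shows "vabs (ev u (fls_X ^ j)) \<le> B / q"
  using Delta_pow_approx[OF assms(1,2) int_ring_1, of j] Delta_pow_eq_0[OF assms(1,3)] by simp

text \<open>As \<open>\<delta>\<^sub>0\<close> is close to \<open>\<Sum>\<sigma>\<^sub>l \<rho>\<^sub>x\<^sup>l\<close>, only the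
  values of \<open>u\<close> at higher powers of \<open>x\<close> intervene.\<close>

lemma S_leading:
  assumes u: "u \<in> LP" "bounded_by (ev u) B" "B / q \<le> c"
    and tail: "\<And>j. Suc i < j \<Longrightarrow> vabs (ev u (fls_X ^ j)) \<le> c"
  shows "vabs (ev (S u) (fls_X ^ i) - \<sigma> 1 * ev u (fls_X ^ Suc i)) \<le> c"
proof -
  \<comment> \<open>\<open>Suc\<close> makes the range \<open>{1..n}\<close> nonempty, so that the
    leading term can be split off.\<close>
  define n where "n = Suc (Polynomial.degree u)"
  define f where "f l = \<sigma> l * ev u (fls_X ^ l * fls_X ^ i)" for l
  have c: "0 \<le> c" using bounded_by_nonneg[OF u(2)] u(3) by (meson divide_nonneg_nonneg of_nat_0_le_iff order_trans)
  have "vabs (ev (S u) (fls_X ^ i) - sum f {1..n}) \<le> B / q"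
    unfolding f_def using u vabs_\<sigma> int_ring_X_power by (intro Delta_series_approx) (auto simp: n_def)
  \<comment> \<open>For \<open>l \<ge> 2\<close> the evaluation point is \<open>x^(l+i)\<close> with
    \<open>l + i > Suc i\<close>, where \<open>tail\<close> applies.\<close>
  moreover have "vabs (sum f {2..n}) \<le> c"
    unfolding f_def using c by (intro vabs_sum_le vabs_unit_mult_le vabs_\<sigma>) (auto intro!: tail simp flip: power_add)
  ultimately have "vabs (ev (S u) (fls_X ^ i) - sum f {1..n} + sum f {2..n}) \<le> c"
    using u(3) by (intro vabs_add_le) auto
  moreover have "sum f {1..n} = f 1 + sum f {2..n}"
    by (simp add: n_def sum.atLeast_Suc_atMost numeral_2_eq_2)
  ultimately show ?thesis by (simp add: f_def)
qed

text \<open>The set of exponents \<open>j\<close> with \<open>|u(x^j)| > c\<close> is finite by the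
  tail estimate and omits 0 because \<open>u(1) = 0\<close>. One step below its maximum,
  \<open>S_leading\<close> identifies the value there, up to the unit \<open>\<sigma> 1\<close> and
  an error at most \<open>c\<close>, with a value of \<open>S u\<close>, which is at most
  \<open>1 \<le> c\<close>.\<close>

lemma contraction:
  assumes u: "u \<in> LP" "bounded_by (ev u) B" and u1: "poly u 1 = 0"
    and Su: "bounded_by (ev (S u)) 1"
  shows "bounded_by (ev u) (max 1 (B / q))"
proof (rule C0_bounded_by[OF ev_C0[OF u(1)]], rule ccontr)
  define c where "c = max 1 (B / q)"
  define bad where "bad = {j. c < vabs (ev u (fls_X ^ j))}"
  fix j assume "\<not> vabs (ev u (fls_X ^ j)) \<le> max 1 (B / q)"
  then have "j \<in> bad" by (simp only: bad_def c_def mem_Collect_eq not_le)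
  have "bad \<subseteq> {..Polynomial.degree u}"
  proof (rule subsetI, rule ccontr)
    fix m assume "m \<in> bad" "m \<notin> {..Polynomial.degree u}"
    then have "Polynomial.degree u < q ^ m" using less_q_power[of m] by simp
    then have "vabs (ev u (fls_X ^ m)) \<le> c"
      using ev_X_power_tail[OF u] by (force simp: c_def)
    then show False using \<open>m \<in> bad\<close> by (simp add: bad_def)
  qed
  then have fin: "finite bad" by (rule finite_subset) simp
  define k where "k = Max bad"
  have k: "k \<in> bad" using Max_in[OF fin] \<open>j \<in> bad\<close> by (auto simp: k_def)
  have "k \<noteq> 0"
  proof
    assume "k = 0"
    then have "vabs (ev u (fls_X ^ k)) = 0" by (simp add: u1 \<iota>_1)
    with k show False by (simp add: bad_def c_def)
  qed
  then obtain i where i: "k = Suc i" by (cases k) auto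
  have "vabs (ev u (fls_X ^ m)) \<le> c" if "Suc i < m" for m
    using Max_ge[OF fin, of m] that i by (force simp: k_def bad_def)
  then have "vabs (ev (S u) (fls_X ^ i) - \<sigma> 1 * ev u (fls_X ^ Suc i)) \<le> c"
    by (intro S_leading[OF u]) (auto simp: c_def)
  moreover have "vabs (ev (S u) (fls_X ^ i)) \<le> c"
    using bounded_byD[OF Su int_ring_X_power[of i]] by (simp add: c_def)
  ultimately have "vabs (ev (S u) (fls_X ^ i) - (ev (S u) (fls_X ^ i) - \<sigma> 1 * ev u (fls_X ^ Suc i))) \<le> c"
    by (rule vabs_diff_le[rotated])
  then show False using k i vabs_\<sigma>_1 by (simp add: bad_def vabs_mult)
qed

lemma bounded_by_mono: "bounded_by f B \<Longrightarrow> B \<le> C \<Longrightarrow> bounded_by f C"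
  unfolding bounded_by_def by (meson order_trans)

text \<open>After \<open>n\<close> contractions any initial bound \<open>B\<close> becomes
  \<open>max 1 (B / q ^ n)\<close>, which is 1 once \<open>q ^ n\<close> exceeds
  \<open>B\<close>.\<close>

lemma bounded_by_1_if_S:
  assumes u: "u \<in> LP" "poly u 1 = 0" "bounded_by (ev (S u)) 1"
  shows "bounded_by (ev u) 1"
proof -
  obtain B where B: "bounded_by (ev u) B" using ev_bounded[OF u(1)] .
  have "bounded_by (ev u) (max 1 (B / q ^ n))" for n
  proof (induction n)
    case (Suc n)
    have "max 1 (max 1 (B / q ^ n) / q) \<le> max 1 (B / q ^ Suc n)"
      using one_less_q by (auto simp: max_def field_simps)
    with contraction[OF u(1) Suc u(2,3)] show ?case by (rule bounded_by_mono)
  qed (use B in \<open>auto elim: bounded_by_mono\<close>)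
  moreover obtain n where "B < q ^ n"
    using real_arch_pow[of "real q" B] one_less_q by auto
  then have "max 1 (B / q ^ n) = 1" using one_less_q by (simp add: max_def field_simps)
  ultimately show ?thesis by metis
qed

lemma bounded_by_Q: "bounded_by (ev (Q n)) 1"
proof (induction n)
  case 0
  show ?case by (rule bounded_byI) (simp add: Q_0 vabs_le_1)
next
  case (Suc n)
  show ?case
  proof (rule bounded_by_1_if_S[OF lin_Q])
    show "bounded_by (ev (S (Q (Suc n)))) 1"
      using Suc by (auto simp: S_Q_Suc vabs_power bounded_by_def intro!: power_le_one)
  qed (simp add: Q_at_1)
qed

lemma vabs_Q_tail: "n < j \<Longrightarrow> vabs (ev (Q n) (fls_X ^ j)) \<le> 1 / q"
  using ev_X_power_tail[OF lin_Q bounded_by_Q, of n j] one_less_q by (simp add: degree_Q)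

text \<open>By \<open>S_leading\<close>, \<open>\<sigma> 1\<close> times the next diagonal value
  differs from the \<open>q\<close>-th power of the present one by at most \<open>1/q\<close>, so
  both have modulus 1.\<close>

lemma vabs_Q_diagonal: "vabs (ev (Q n) (fls_X ^ n)) = 1"
proof (induction n)
  case (Suc n)
  define a where "a = ev (S (Q (Suc n))) (fls_X ^ n)"
  define b where "b = \<sigma> 1 * ev (Q (Suc n)) (fls_X ^ Suc n)"
  have "vabs a = 1" using Suc by (simp add: a_def S_Q_Suc vabs_power)
  moreover have "vabs (a - b) \<le> 1 / q"
    unfolding a_def b_def by (rule S_leading[OF lin_Q bounded_by_Q]) (auto intro: vabs_Q_tail)
  then have "vabs (b - a) < 1"
    using one_less_q by (simp add: vabs_minus_commute[of b a] order_le_less_trans)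
  ultimately have "vabs b = 1" using vabs_add_eq[of "b - a" a] by simp
  then show ?case by (simp add: b_def vabs_mult vabs_\<sigma>_1 del: One_nat_def)
qed (simp add: Q_0 \<iota>_1)

section \<open>Density and coordinates\<close>

text \<open>Triangular elimination modulo \<open>B / q\<close>, by induction on the number of powers
  of \<open>x\<close> not yet known to give small values. A multiple of \<open>Q n\<close> removes
  the last one and, by the tail bound, keeps the later values small.\<close>

lemma approx_step:
  assumes "f \<in> C0 \<iota>" "bounded_by f B" "\<And>j. n \<le> j \<Longrightarrow> vabs (f (fls_X ^ j)) \<le> B / q"
  shows "\<exists>u\<in>LP. bounded_by (\<lambda>t. f t - ev u t) (B / q)"
  using assms
proof (induction n arbitrary: f)
  case 0
  then have "bounded_by f (B / q)" by (intro C0_bounded_by) auto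
  then show ?case by (intro bexI[of _ 0]) (auto simp: lin_0)
next
  case (Suc n)
  \<comment> \<open>The difference then vanishes at \<open>x^n\<close>, and the unit diagonal value
    gives \<open>vabs c \<le> B\<close>.\<close>
  define c where "c = f (fls_X ^ n) / ev (Q n) (fls_X ^ n)"
  define w where "w = Polynomial.smult c (Q n)"
  define g where "g t = f t - ev w t" for t
  have B: "0 \<le> B" using bounded_by_nonneg[OF Suc.prems(2)] .
  have w: "w \<in> LP" by (simp add: w_def lin_smult lin_Q)
  have Qn: "ev (Q n) (fls_X ^ n) \<noteq> 0" using vabs_Q_diagonal[of n] by auto
  then have "c * ev (Q n) (fls_X ^ n) = f (fls_X ^ n)" by (simp add: c_def)
  then have "vabs c = vabs (f (fls_X ^ n))"
    using vabs_mult[of c "ev (Q n) (fls_X ^ n)"] by (simp add: vabs_Q_diagonal)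
  then have c: "vabs c \<le> B" using bounded_byD[OF Suc.prems(2) int_ring_X_power] by metis
  have "bounded_by (ev w) B"
  proof (rule bounded_byI)
    fix t :: "'k fls" assume "t \<in> int_ring"
    then show "vabs (ev w t) \<le> B"
      using vabs_unit_mult_le[OF bounded_byD[OF bounded_by_Q] c, of t n] by (simp add: w_def mult.commute)
  qed
  then have "bounded_by g B" unfolding g_def using Suc.prems(2) by (intro bounded_by_diff)
  moreover have "g \<in> C0 \<iota>" unfolding g_def using Suc.prems(1) w by (intro C0_diff ev_C0)
  moreover have "vabs (g (fls_X ^ j)) \<le> B / q" if "n \<le> j" for j
  proof (cases "j = n")
    case True
    then show ?thesis using Qn B by (simp add: g_def w_def c_def)
  next
    case False
    have "vabs (ev w (fls_X ^ j)) \<le> B * (1 / q)"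
      unfolding w_def poly_smult vabs_mult using c B that False
      by (intro mult_mono vabs_Q_tail) auto
    then show ?thesis
      unfolding g_def using that False by (intro vabs_diff_le Suc.prems(3)) auto
  qed
  ultimately obtain u where u: "u \<in> LP" "bounded_by (\<lambda>t. g t - ev u t) (B / q)"
    using Suc.IH by blast
  show ?case
  proof (rule bexI)
    show "bounded_by (\<lambda>t. f t - ev (u + w) t) (B / q)"
      using u(2) by (simp add: g_def bounded_by_def algebra_simps)
  qed (use u w in \<open>simp add: lin_add\<close>)
qed

text \<open>Each \<open>approx_step\<close> on the current error divides it by \<open>q\<close>.
  Positivity of \<open>B\<close> yields the index beyond which the values at powers of
  \<open>x\<close> are already small.\<close>

lemma approx:
  assumes "f \<in> C0 \<iota>" "bounded_by f B" "0 < B"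
  shows "\<exists>u\<in>LP. bounded_by (\<lambda>t. f t - ev u t) (B / q ^ k)"
proof (induction k)
  case 0
  show ?case using assms(2) by (intro bexI[of _ 0]) (auto simp: lin_0)
next
  case (Suc k)
  then obtain u where u: "u \<in> LP" "bounded_by (\<lambda>t. f t - ev u t) (B / q ^ k)" by blast
  have g: "(\<lambda>t. f t - ev u t) \<in> C0 \<iota>" using assms(1) u(1) by (intro C0_diff ev_C0)
  have "0 < B / q ^ k / q" using assms(3) one_less_q by simp
  then obtain n where "\<And>j. n \<le> j \<Longrightarrow> vabs (f (fls_X ^ j) - ev u (fls_X ^ j)) < B / q ^ k / q"
    using C0_X_power_small[OF g] by blast
  then obtain v where v: "v \<in> LP" "bounded_by (\<lambda>t. f t - ev u t - ev v t) (B / q ^ k / q)"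
    using approx_step[OF g u(2), of n] by (meson less_imp_le)
  show ?case
  proof (rule bexI)
    show "bounded_by (\<lambda>t. f t - ev (u + v) t) (B / q ^ Suc k)"
      using v(2) by (simp add: bounded_by_def algebra_simps)
  qed (use u v in \<open>simp add: lin_add\<close>)
qed

lemma lin_approx_iff:
  "lin_approx q \<iota> F f \<longleftrightarrow> (\<forall>N. F N \<in> LP) \<and>
     (\<forall>e>0. \<exists>N. \<forall>n\<ge>N. bounded_by (\<lambda>t. f t - ev (F n) t) e)"
proof -
  have "uniform_limit int_ring (\<lambda>N t. ev (F N) t) f sequentially \<longleftrightarrow>
      (\<forall>e>0. \<exists>N. \<forall>n\<ge>N. \<forall>t\<in>int_ring. vabs (f t - ev (F n) t) < e)"
    by (simp add: uniform_limit_iff eventually_sequentially dist_vabs vabs_minus_commute)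
  also have "\<dots> \<longleftrightarrow> (\<forall>e>0. \<exists>N. \<forall>n\<ge>N. bounded_by (\<lambda>t. f t - ev (F n) t) e)"
    unfolding bounded_by_def
  proof safe
    fix e :: real assume "\<forall>e>0. \<exists>N. \<forall>n\<ge>N. \<forall>t\<in>int_ring. vabs (f t - ev (F n) t) < e" "0 < e"
    then show "\<exists>N. \<forall>n\<ge>N. \<forall>t\<in>int_ring. vabs (f t - ev (F n) t) \<le> e" by (meson less_imp_le)
  next
    fix e :: real assume *: "\<forall>e>0. \<exists>N. \<forall>n\<ge>N. \<forall>t\<in>int_ring. vabs (f t - ev (F n) t) \<le> e" "0 < e"
    then have "0 < e / 2" "e / 2 < e" by auto
    then show "\<exists>N. \<forall>n\<ge>N. \<forall>t\<in>int_ring. vabs (f t - ev (F n) t) < e"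
      using * by (meson order_le_less_trans)
  qed
  finally show ?thesis by (simp add: lin_approx_def)
qed

lemma lin_approx_exists:
  assumes f: "f \<in> C0 \<iota>"
  obtains F where "lin_approx q \<iota> F f"
proof -
  obtain B where "bounded_by f B" using C0_bounded[OF f] .
  \<comment> \<open>The maximum with 1 supplies the positive bound that \<open>approx\<close>
    requires.\<close>
  then have B: "bounded_by f (max B 1)" by (rule bounded_by_mono) simp
  have "\<exists>u. u \<in> LP \<and> bounded_by (\<lambda>t. f t - ev u t) (max B 1 / q ^ k)" for k
    using approx[OF f B, of k] by (auto simp: less_max_iff_disj)
  then obtain F where F: "\<And>k. F k \<in> LP" "\<And>k. bounded_by (\<lambda>t. f t - ev (F k) t) (max B 1 / q ^ k)"
    by metis
  have "\<exists>N. \<forall>n\<ge>N. bounded_by (\<lambda>t. f t - ev (F n) t) e" if e: "0 < e" for e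
  proof -
    obtain N where N: "max B 1 / e < real q ^ N"
      using real_arch_pow[of "real q" "max B 1 / e"] one_less_q by auto
    have "max B 1 / q ^ n \<le> e" if "N \<le> n" for n
    proof -
      have "real q ^ N \<le> real q ^ n" using that one_less_q by simp
      with N have "max B 1 / e \<le> real q ^ n" by simp
      then show ?thesis using e one_less_q by (simp add: field_simps)
    qed
    then show ?thesis using F(2) bounded_by_mono by blast
  qed
  then show ?thesis using F(1) by (intro that) (auto simp: lin_approx_iff)
qed

section \<open>The coordinate functionals dual to the basis\<close>

abbreviation coord :: "nat \<Rightarrow> 'c poly \<Rightarrow> 'c" where
  "coord n u \<equiv> poly (divided_power q \<delta> n u) 1"

lemma coord_eq: "coord n u = poly ((\<delta> ^^ n) u) 1 ^ (q ^ n)"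
  by (simp add: divided_power_def tau_funpow poly_power)

lemma lin_\<delta>_funpow: "u \<in> LP \<Longrightarrow> (\<delta> ^^ n) u \<in> LP"
  by (cases n) (auto simp: lin_\<delta>)

lemma \<delta>_add: "u \<in> LP \<Longrightarrow> v \<in> LP \<Longrightarrow> \<delta> (u + v) = \<delta> u + \<delta> v"
  using poly_add_power_q[of "\<delta> u" "\<delta> v" 1]
  by (intro \<delta>_eqI) (auto simp: lin_add lin_\<delta> Delta_series_add \<delta>_power)

lemma \<delta>_smult: "u \<in> LP \<Longrightarrow> \<delta> (Polynomial.smult (c ^ q) u) = Polynomial.smult c (\<delta> u)"
  by (intro \<delta>_eqI) (auto simp: lin_smult lin_\<delta> Delta_series_smult \<delta>_power smult_power)

lemma \<delta>_0: "\<delta> 0 = 0"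
  using \<delta>_smult[of 0 0] one_less_q by (simp add: lin_0 zero_power)

lemma \<delta>_funpow_0: "(\<delta> ^^ n) 0 = 0"
  by (induction n) (simp_all add: \<delta>_0)

lemma \<delta>_funpow_add: "u \<in> LP \<Longrightarrow> v \<in> LP \<Longrightarrow> (\<delta> ^^ n) (u + v) = (\<delta> ^^ n) u + (\<delta> ^^ n) v"
  by (induction n) (simp_all add: \<delta>_add lin_\<delta>_funpow)

lemma \<delta>_funpow_smult:
  "u \<in> LP \<Longrightarrow> (\<delta> ^^ n) (Polynomial.smult (c ^ (q ^ n)) u) = Polynomial.smult c ((\<delta> ^^ n) u)"
proof (induction n arbitrary: c)
  case (Suc n)
  have "c ^ (q ^ Suc n) = (c ^ q) ^ (q ^ n)" by (simp add: power_mult)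
  then show ?case using Suc by (simp add: \<delta>_smult lin_\<delta>_funpow)
qed simp

lemma root_exists: "\<exists>b. b ^ (q ^ n) = (c::'c)"
proof (induction n)
  case (Suc n)
  then obtain b where "b ^ (q ^ n) = c" by blast
  then have "qroot q b ^ (q ^ Suc n) = c" by (simp add: power_mult qroot_power)
  then show ?case by blast
qed simp

lemma coord_add: "u \<in> LP \<Longrightarrow> v \<in> LP \<Longrightarrow> coord n (u + v) = coord n u + coord n v"
  by (simp add: coord_eq \<delta>_funpow_add add_power_q)

text \<open>With \<open>c = b ^ (q ^ n)\<close>, the iterated \<open>\<delta>\<close> pulls out
  \<open>b\<close>, and the outer power turns it back into \<open>c\<close>.\<close>

lemma coord_smult:
  assumes "u \<in> LP"
  shows "coord n (Polynomial.smult c u) = c * coord n u"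
proof -
  obtain b where "b ^ (q ^ n) = c" using root_exists by blast
  then show ?thesis using \<delta>_funpow_smult[OF assms, of n b] by (auto simp: coord_eq power_mult_distrib)
qed

lemma coord_diff:
  assumes "u \<in> LP" "v \<in> LP"
  shows "coord n (u - v) = coord n u - coord n v"
  using coord_add[OF lin_diff[OF assms] assms(2), of n] by simp

lemma coord_0: "coord n 0 = 0"
  using one_less_q by (simp add: coord_eq \<delta>_funpow_0)

lemma coord_sum: "(\<And>i. i \<in> A \<Longrightarrow> u i \<in> LP) \<Longrightarrow> coord n (sum u A) = (\<Sum>i\<in>A. coord n (u i))"
  by (induction A rule: infinite_finite_induct) (auto simp: coord_0 coord_add lin_sum)

text \<open>\<open>|\<delta> u|^q = |S u|\<close>, and \<open>S\<close> does not enlarge bounds; so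
  \<open>\<delta>\<close> takes \<open>q\<close>-th roots of bounds.\<close>

lemma bounded_by_\<delta>:
  assumes "u \<in> LP" "bounded_by (ev u) (C ^ q)" "0 \<le> C"
  shows "bounded_by (ev (\<delta> u)) C"
proof (rule bounded_byI)
  fix t :: "'k fls" assume t: "t \<in> int_ring"
  have "vabs (ev (\<delta> u) t) ^ q = vabs (ev (S u) t)"
    by (simp flip: vabs_power poly_power \<delta>_power[OF assms(1)])
  also have "\<dots> \<le> C ^ q"
    using bounded_byD[OF bounded_by_Delta_series[OF assms(1,2)] t] vabs_\<sigma> by auto
  finally show "vabs (ev (\<delta> u) t) \<le> C" using assms(3) one_less_q by (simp add: power_mono_iff)
qed

lemma bounded_by_\<delta>_funpow:
  assumes "u \<in> LP" "bounded_by (ev u) (C ^ (q ^ n))" "0 \<le> C"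
  shows "bounded_by (ev ((\<delta> ^^ n) u)) C"
  using assms(1,2)
proof (induction n arbitrary: u)
  case (Suc n)
  have "bounded_by (ev (\<delta> u)) (C ^ (q ^ n))"
    using Suc.prems assms(3) by (intro bounded_by_\<delta>) (auto simp: mult.commute simp flip: power_mult)
  then have "bounded_by (ev ((\<delta> ^^ n) (\<delta> u))) C" by (intro Suc.IH lin_\<delta>)
  then show ?case by (simp add: funpow_swap1)
qed simp

lemma vabs_coord_le:
  assumes "u \<in> LP" "bounded_by (ev u) B"
  shows "vabs (coord n u) \<le> B"
proof -
  have B: "0 \<le> B" using bounded_by_nonneg[OF assms(2)] .
  \<comment> \<open>The real root is chosen so that \<open>n\<close> applications of
    \<open>\<delta>\<close> bring the bound from \<open>B\<close> to \<open>C\<close>, and the outer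
    power restores \<open>B\<close>.\<close>
  define C where "C = root (q ^ n) B"
  have C: "C ^ (q ^ n) = B" "0 \<le> C" using one_less_q B by (auto simp: C_def)
  then have "bounded_by (ev ((\<delta> ^^ n) u)) C" using assms by (intro bounded_by_\<delta>_funpow) auto
  from bounded_byD[OF this int_ring_1] have "vabs (poly ((\<delta> ^^ n) u) 1) \<le> C" by (simp add: \<iota>_1)
  then have "vabs (poly ((\<delta> ^^ n) u) 1) ^ (q ^ n) \<le> C ^ (q ^ n)" by (intro power_mono) auto
  then show ?thesis by (simp add: coord_eq vabs_power C)
qed

lemma \<delta>_funpow_Q: "(\<delta> ^^ k) (Q n) = (if k \<le> n then Q (n - k) else 0)"
proof (induction k)
  case (Suc k)
  show ?case
  proof (cases "k < n")
    case True
    then have "n - k = Suc (n - Suc k)" by simp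
    then show ?thesis using Suc True \<delta>_Q_Suc[of "n - Suc k"] by simp
  qed (use Suc in \<open>auto simp: \<delta>_0 \<delta>_Q_0\<close>)
qed simp

lemma coord_Q: "coord k (Q n) = (if k = n then 1 else 0)"
  using one_less_q by (auto simp: coord_eq \<delta>_funpow_Q Q_at_1)

section \<open>Finite expansions of linear polynomials\<close>

lemma lin_span:
  assumes "u \<in> LP" "Polynomial.degree u < q ^ m"
  shows "\<exists>a. u = (\<Sum>n<m. Polynomial.smult (a n) (Q n))"
  using assms
proof (induction m arbitrary: u)
  case 0
  \<comment> \<open>Degree below \<open>q ^ 0 = 1\<close> leaves no admissible exponent.\<close>
  have "u = 0"
  proof (rule poly_eqI_lin[OF 0(1) lin_0])
    fix k show "Polynomial.coeff u (q ^ k) = Polynomial.coeff 0 (q ^ k)"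
      using 0(2) one_less_q by (simp add: coeff_eq_0)
  qed
  then show ?case by simp
next
  case (Suc m)
  define c where "c = Polynomial.coeff u (q ^ m) / Polynomial.coeff (Q m) (q ^ m)"
  define v where "v = u - Polynomial.smult c (Q m)"
  have "Q m \<noteq> 0" using degree_Q[of m] one_less_q by force
  then have lead: "Polynomial.coeff (Q m) (q ^ m) \<noteq> 0" using degree_Q[of m] by (metis leading_coeff_0_iff)
  have v: "v \<in> LP" unfolding v_def by (intro lin_diff lin_smult Suc.prems(1) lin_Q)
  \<comment> \<open>The choice of \<open>c\<close> cancels exponent \<open>q ^ m\<close>; the next
    admissible one, \<open>q ^ Suc m\<close>, exceeds the degrees of both \<open>u\<close> and
    \<open>Q m\<close>.\<close>
  have "Polynomial.coeff v i = 0" if i: "q ^ m \<le> i" for i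
  proof (rule ccontr)
    assume nz: "Polynomial.coeff v i \<noteq> 0"
    then obtain k where k: "i = q ^ k" using v by (auto simp: lin_polys_def)
    with i have "m \<le> k" using one_less_q by simp
    show False
    proof (cases "k = m")
      case True
      then show False using nz k lead by (simp add: v_def c_def)
    next
      case False
      with \<open>m \<le> k\<close> have "q ^ Suc m \<le> i" using one_less_q k by (intro power_increasing[of "Suc m" k q, THEN order_trans]) auto
      then have "Polynomial.coeff u i = 0" using Suc.prems(2) by (intro coeff_eq_0) simp
      moreover have "q ^ m < q ^ Suc m" using one_less_q by simp
      then have "Polynomial.coeff (Q m) i = 0"
        using \<open>q ^ Suc m \<le> i\<close> by (intro coeff_eq_0) (unfold degree_Q, rule less_le_trans)
      ultimately show False using nz by (simp add: v_def)
    qed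
  qed
  then have "Polynomial.degree v < q ^ m"
    using one_less_q by (intro degree_lessI) auto
  then obtain a where a: "v = (\<Sum>n<m. Polynomial.smult (a n) (Q n))"
    using Suc.IH[OF v] by blast
  have "u = (\<Sum>n<Suc m. Polynomial.smult ((a(m := c)) n) (Q n))"
    using a by (simp add: v_def algebra_simps)
  then show ?case by blast
qed

lemma coord_sum_Q: "coord k (\<Sum>n<m. Polynomial.smult (a n) (Q n)) = (if k < m then a k else 0)"
proof -
  have "coord k (\<Sum>n<m. Polynomial.smult (a n) (Q n)) = (\<Sum>n<m. a n * coord k (Q n))"
    by (subst coord_sum) (simp_all only: lin_smult lin_Q coord_smult)
  also have "\<dots> = (\<Sum>n<m. if k = n then a n else 0)"
    by (intro sum.cong) (simp_all only: coord_Q, auto)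
  finally show ?thesis by simp
qed

text \<open>Biorthogonality reads off the coefficients of the combination given by
  \<open>lin_span\<close>.\<close>

lemma lin_expansion:
  assumes "u \<in> LP" "Polynomial.degree u < q ^ m"
  shows "u = (\<Sum>n<m. Polynomial.smult (coord n u) (Q n))" "m \<le> n \<Longrightarrow> coord n u = 0"
proof -
  obtain a where a: "u = (\<Sum>n<m. Polynomial.smult (a n) (Q n))"
    using lin_span[OF assms] by blast
  then show "m \<le> n \<Longrightarrow> coord n u = 0" by (simp only: coord_sum_Q) simp
  have "coord n u = a n" if "n < m" for n using a that by (simp only: coord_sum_Q) simp
  then have "(\<Sum>n<m. Polynomial.smult (coord n u) (Q n)) = (\<Sum>n<m. Polynomial.smult (a n) (Q n))"
    by (intro sum.cong) auto
  with a show "u = (\<Sum>n<m. Polynomial.smult (coord n u) (Q n))" by simp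
qed

section \<open>Expansions of continuous functions\<close>

lemma lin_approx_bounded:
  assumes "lin_approx q \<iota> F f" "0 < e"
  obtains N where "\<And>n. N \<le> n \<Longrightarrow> bounded_by (\<lambda>t. f t - ev (F n) t) e"
  using assms unfolding lin_approx_iff by blast

text \<open>\<open>u - v\<close> is the difference of two errors, hence at most \<open>e\<close> by
  the ultrametric inequality, and the functionals have norm at most 1.\<close>

lemma coord_close:
  assumes "u \<in> LP" "v \<in> LP"
    and "bounded_by (\<lambda>t. f t - ev u t) e" "bounded_by (\<lambda>t. f t - ev v t) e"
  shows "vabs (coord n u - coord n v) \<le> e"
proof -
  have "bounded_by (ev (u - v)) e"
    using bounded_by_diff[OF assms(4,3)] by (simp add: bounded_by_def)
  then show ?thesis
    using vabs_coord_le[OF lin_diff[OF assms(1,2)]] by (simp only: coord_diff[OF assms(1,2)])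
qed

lemma coord_convergent:
  assumes F: "lin_approx q \<iota> F f"
  obtains y where "(\<lambda>N. coord n (F N)) \<longlonglongrightarrow> y"
proof -
  have lin: "F N \<in> LP" for N using F by (simp add: lin_approx_def)
  have "Cauchy (\<lambda>N. coord n (F N))"
    unfolding Cauchy_def dist_vabs
  proof (intro allI impI)
    fix e :: real assume "0 < e"
    then obtain N where "\<And>m. N \<le> m \<Longrightarrow> bounded_by (\<lambda>t. f t - ev (F m) t) (e / 2)"
      using lin_approx_bounded[OF F, of "e / 2"] by auto
    then have "vabs (coord n (F k) - coord n (F m)) \<le> e / 2" if "N \<le> k" "N \<le> m" for k m
      using coord_close[OF lin lin] that by blast
    moreover have "e / 2 < e" using \<open>0 < e\<close> by simp
    ultimately show "\<exists>N. \<forall>k\<ge>N. \<forall>m\<ge>N. vabs (coord n (F k) - coord n (F m)) < e"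
      by (meson order_le_less_trans)
  qed
  then show ?thesis using that Cauchy_convergent_iff convergent_def by blast
qed

text \<open>Completeness gives the limit along one approximating sequence;
  \<open>coord_close\<close> forces every other sequence to the same limit.\<close>

lemma delta_value_exists:
  assumes f: "f \<in> C0 \<iota>"
  shows "\<exists>y. delta_value q \<iota> \<delta> n f y"
proof -
  obtain F where F: "lin_approx q \<iota> F f" using lin_approx_exists[OF f] .
  obtain y where y: "(\<lambda>N. coord n (F N)) \<longlonglongrightarrow> y" using coord_convergent[OF F] .
  have "(\<lambda>N. coord n (G N)) \<longlonglongrightarrow> y" if G: "lin_approx q \<iota> G f" for G
    unfolding lim_sequentially dist_vabs
  proof (intro allI impI)
    fix e :: real assume "0 < e"
    then have e: "0 < e / 2" "e / 2 < e" by auto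
    obtain N1 where N1: "\<And>m. N1 \<le> m \<Longrightarrow> bounded_by (\<lambda>t. f t - ev (F m) t) (e / 2)"
      using lin_approx_bounded[OF F e(1)] by blast
    obtain N2 where N2: "\<And>m. N2 \<le> m \<Longrightarrow> bounded_by (\<lambda>t. f t - ev (G m) t) (e / 2)"
      using lin_approx_bounded[OF G e(1)] by blast
    obtain N3 where N3: "\<And>m. N3 \<le> m \<Longrightarrow> vabs (coord n (F m) - y) < e / 2"
      using y e(1) unfolding lim_sequentially dist_vabs by blast
    have "vabs (coord n (G m) - y) < e" if m: "max N1 (max N2 N3) \<le> m" for m
    proof -
      have "vabs (coord n (G m) - coord n (F m)) \<le> e / 2"
        using F G m by (intro coord_close[where f = f] N1 N2) (auto simp: lin_approx_def)
      moreover have "vabs (coord n (F m) - y) \<le> e / 2" using N3[of m] m by simp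
      ultimately have "vabs ((coord n (G m) - coord n (F m)) + (coord n (F m) - y)) \<le> e / 2"
        by (rule vabs_add_le)
      then show ?thesis using e(2) by simp
    qed
    then show "\<exists>N. \<forall>m\<ge>N. vabs (coord n (G m) - y) < e" by blast
  qed
  then show ?thesis using F by (auto simp: delta_value_def)
qed

text \<open>The limiting form of \<open>coord_close\<close>, with one approximant tending to
  \<open>f\<close>.\<close>

lemma delta_value_close:
  assumes "delta_value q \<iota> \<delta> n f y" "u \<in> LP" "bounded_by (\<lambda>t. f t - ev u t) e" "0 < e"
  shows "vabs (coord n u - y) \<le> e"
proof -
  obtain F where F: "lin_approx q \<iota> F f" and lim: "(\<lambda>N. coord n (F N)) \<longlonglongrightarrow> y"
    using assms(1) unfolding delta_value_def by blast
  obtain N1 where N1: "\<And>m. N1 \<le> m \<Longrightarrow> bounded_by (\<lambda>t. f t - ev (F m) t) e"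
    using lin_approx_bounded[OF F assms(4)] by blast
  obtain N2 where N2: "\<And>m. N2 \<le> m \<Longrightarrow> vabs (coord n (F m) - y) < e"
    using lim assms(4) unfolding lim_sequentially dist_vabs by blast
  define m where "m = max N1 N2"
  have "vabs (coord n u - coord n (F m)) \<le> e"
    using F by (intro coord_close[where f = f] assms N1) (auto simp: lin_approx_def m_def)
  moreover have "vabs (coord n (F m) - y) \<le> e" using N2[of m] by (simp add: m_def)
  ultimately have "vabs ((coord n u - coord n (F m)) + (coord n (F m) - y)) \<le> e"
    by (rule vabs_add_le)
  then show ?thesis by simp
qed

section \<open>Expansion, norm formula and uniqueness for a fixed function\<close>

context
  fixes f and \<psi> :: "nat \<Rightarrow> 'c"
  assumes f: "f \<in> C0 \<iota>" and \<psi>: "\<And>n. delta_value q \<iota> \<delta> n f (\<psi> n)"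
begin

text \<open>A polynomial \<open>u\<close> within \<open>e\<close> of \<open>f\<close> has
  coordinates within \<open>e\<close> of the \<open>\<psi> i\<close>, all zero from \<open>m\<close>
  on. The error of the partial sum is \<open>f - u\<close> plus a sum of these differences times
  \<open>Q i\<close>, each term at most \<open>e\<close>.\<close>

lemma partial_sums_close:
  assumes "0 < e"
  shows "\<exists>m. \<forall>n\<ge>m. vabs (\<psi> n) \<le> e \<and> bounded_by (\<lambda>t. f t - (\<Sum>i<n. \<psi> i * ev (Q i) t)) e"
proof -
  obtain F where F: "lin_approx q \<iota> F f" using lin_approx_exists[OF f] .
  then obtain N where "bounded_by (\<lambda>t. f t - ev (F N) t) e"
    using lin_approx_bounded[OF F assms] by blast
  then obtain u where u: "u \<in> LP" "bounded_by (\<lambda>t. f t - ev u t) e"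
    using F by (auto simp: lin_approx_def)
  define m where "m = Suc (Polynomial.degree u)"
  have deg: "Polynomial.degree u < q ^ n" if "m \<le> n" for n
    using that less_q_power[of n] by (simp add: m_def)
  have close: "vabs (coord n u - \<psi> n) \<le> e" for n
    by (rule delta_value_close[OF \<psi> u assms])
  show ?thesis
  proof (intro exI allI impI conjI)
    fix n assume n: "m \<le> n"
    have "coord n u = 0" using lin_expansion(2)[OF u(1) deg[OF n]] by simp
    then show "vabs (\<psi> n) \<le> e" using close[of n] by (simp only: diff_0 vabs_minus)
    have u_eq: "ev u t = (\<Sum>i<n. coord i u * ev (Q i) t)" for t
      by (subst lin_expansion(1)[OF u(1) deg[OF n]]) (simp only: poly_sum poly_smult)
    show "bounded_by (\<lambda>t. f t - (\<Sum>i<n. \<psi> i * ev (Q i) t)) e"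
    proof (rule bounded_byI)
      fix t :: "'k fls" assume t: "t \<in> int_ring"
      have "vabs (ev (Q i) t * (coord i u - \<psi> i)) \<le> e" for i
        by (rule vabs_unit_mult_le[OF bounded_byD[OF bounded_by_Q t] close])
      then have "vabs (\<Sum>i<n. ev (Q i) t * (coord i u - \<psi> i)) \<le> e"
        using assms by (intro vabs_sum_le) auto
      then have "vabs ((f t - ev u t) + (\<Sum>i<n. ev (Q i) t * (coord i u - \<psi> i))) \<le> e"
        by (intro vabs_add_le bounded_byD[OF u(2) t])
      moreover have "(\<Sum>i<n. ev (Q i) t * (coord i u - \<psi> i)) = ev u t - (\<Sum>i<n. \<psi> i * ev (Q i) t)"
        unfolding u_eq by (simp only: sum_subtractf right_diff_distrib mult.commute)
      ultimately show "vabs (f t - (\<Sum>i<n. \<psi> i * ev (Q i) t)) \<le> e" by simp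
    qed
  qed
qed

lemma coefficients_tendsto_0: "(\<lambda>n. vabs (\<psi> n)) \<longlonglongrightarrow> 0"
  unfolding lim_sequentially
proof (intro allI impI)
  fix e :: real assume "0 < e"
  then have e: "0 < e / 2" "e / 2 < e" by auto
  obtain m where m: "\<forall>n\<ge>m. vabs (\<psi> n) \<le> e / 2" using partial_sums_close[OF e(1)] by meson
  have "dist (vabs (\<psi> n)) 0 < e" if "m \<le> n" for n
    using m[rule_format, OF that] e(2) by simp
  then show "\<exists>m. \<forall>n\<ge>m. dist (vabs (\<psi> n)) 0 < e" by blast
qed

lemma expansion: "expansion (\<lambda>n. ev (Q n)) \<psi> f"
  unfolding expansion_def uniform_limit_iff eventually_sequentially
proof (intro allI impI)
  fix e :: real assume "0 < e"
  then have e: "0 < e / 2" "e / 2 < e" by auto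
  obtain m where m: "\<And>n. m \<le> n \<Longrightarrow> bounded_by (\<lambda>t. f t - (\<Sum>i<n. \<psi> i * ev (Q i) t)) (e / 2)"
    using partial_sums_close[OF e(1)] by meson
  have "dist (\<Sum>i<n. \<psi> i * ev (Q i) t) (f t) < e" if "m \<le> n" "t \<in> int_ring" for n t
    using bounded_byD[OF m[OF that(1)] that(2)] e(2)
    unfolding dist_vabs vabs_minus_commute[of _ "f t"] by (rule order_le_less_trans)
  then show "\<exists>N. \<forall>n\<ge>N. \<forall>t\<in>int_ring. dist (\<Sum>i<n. \<psi> i * ev (Q i) t) (f t) < e" by blast
qed

text \<open>One direction uses that the functionals have norm at most 1, the other that the
  \<open>Q n\<close> do; a polynomial approximant or a partial sum transfers this to
  \<open>f\<close>.\<close>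

lemma bounded_by_iff_coefficients: "bounded_by f B \<longleftrightarrow> (\<forall>n. vabs (\<psi> n) \<le> B)"
proof
  assume B: "bounded_by f B"
  show "\<forall>n. vabs (\<psi> n) \<le> B"
  proof (rule allI, rule ccontr)
    fix n assume "\<not> vabs (\<psi> n) \<le> B"
    then have n: "B < vabs (\<psi> n)" by simp
    \<comment> \<open>Half of the offending value is a positive tolerance whose maximum with
      \<open>B\<close> is still below that value.\<close>
    then have e: "0 < vabs (\<psi> n) / 2" using bounded_by_nonneg[OF B] by simp
    obtain F where F: "lin_approx q \<iota> F f" using lin_approx_exists[OF f] .
    obtain N where N: "bounded_by (\<lambda>t. f t - ev (F N) t) (vabs (\<psi> n) / 2)"
      using lin_approx_bounded[OF F e] by blast
    have lin: "F N \<in> LP" using F by (simp add: lin_approx_def)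
    define M where "M = max B (vabs (\<psi> n) / 2)"
    have M: "M < vabs (\<psi> n)" using n e by (simp add: M_def)
    have "bounded_by (\<lambda>t. f t - (f t - ev (F N) t)) M"
      by (rule bounded_by_diff[OF bounded_by_mono[OF B] bounded_by_mono[OF N]]) (auto simp: M_def)
    then have "bounded_by (ev (F N)) M" by simp
    then have "vabs (coord n (F N)) \<le> M" by (rule vabs_coord_le[OF lin])
    moreover have "vabs (coord n (F N) - \<psi> n) \<le> M"
      using delta_value_close[OF \<psi> lin N e] by (rule order_trans) (simp add: M_def)
    ultimately have "vabs (coord n (F N) - (coord n (F N) - \<psi> n)) \<le> M" by (rule vabs_diff_le)
    then show False using M by simp
  qed
next
  assume B: "\<forall>n. vabs (\<psi> n) \<le> B"
  then have B0: "0 \<le> B" using vabs_nonneg order_trans by blast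
  show "bounded_by f B"
  proof (rule bounded_byI, rule ccontr)
    fix t :: "'k fls" assume t: "t \<in> int_ring" and "\<not> vabs (f t) \<le> B"
    then have n: "B < vabs (f t)" by simp
    \<comment> \<open>The same choice of tolerance, now against \<open>vabs (f t)\<close>.\<close>
    then have e: "0 < vabs (f t) / 2" using B0 by simp
    define M where "M = max B (vabs (f t) / 2)"
    have M: "M < vabs (f t)" using n e by (simp add: M_def)
    obtain m where m: "bounded_by (\<lambda>t. f t - (\<Sum>i<m. \<psi> i * ev (Q i) t)) (vabs (f t) / 2)"
      using partial_sums_close[OF e] by blast
    have "vabs (ev (Q i) t * \<psi> i) \<le> B" for i
      by (rule vabs_unit_mult_le[OF bounded_byD[OF bounded_by_Q t]]) (use B in blast)
    then have "vabs (\<Sum>i<m. \<psi> i * ev (Q i) t) \<le> B"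
      using B0 by (intro vabs_sum_le) (auto simp: mult.commute)
    then have "vabs (\<Sum>i<m. \<psi> i * ev (Q i) t) \<le> M" by (simp add: M_def)
    moreover have "vabs (f t - (\<Sum>i<m. \<psi> i * ev (Q i) t)) \<le> M"
      using bounded_byD[OF m t] by (simp add: M_def)
    ultimately have "vabs ((f t - (\<Sum>i<m. \<psi> i * ev (Q i) t)) + (\<Sum>i<m. \<psi> i * ev (Q i) t)) \<le> M"
      by (intro vabs_add_le)
    then show False using M by simp
  qed
qed

text \<open>Both suprema are least bounds, and by the preceding equivalence they bound the same
  things.\<close>

lemma sup_norm_eq: "sup_norm f = (SUP n. vabs (\<psi> n))"
proof -
  obtain B where B: "bounded_by f B" using C0_bounded[OF f] .
  have bdd: "bdd_above ((\<lambda>t. vabs (f t)) ` int_ring)" "bdd_above (range (\<lambda>n. vabs (\<psi> n)))"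
    using B bounded_by_iff_coefficients[of B] by (auto simp: bounded_by_def intro!: bdd_aboveI2)
  have "bounded_by f (SUP t\<in>int_ring. vabs (f t))"
    by (intro bounded_byI cSUP_upper bdd)
  then have "vabs (\<psi> n) \<le> (SUP t\<in>int_ring. vabs (f t))" for n
    using bounded_by_iff_coefficients by blast
  then have "(SUP n. vabs (\<psi> n)) \<le> (SUP t\<in>int_ring. vabs (f t))" by (intro cSUP_least) auto
  moreover have "vabs (\<psi> n) \<le> (SUP n. vabs (\<psi> n))" for n
    by (intro cSUP_upper bdd) simp
  then have "bounded_by f (SUP n. vabs (\<psi> n))" using bounded_by_iff_coefficients by blast
  then have "(SUP t\<in>int_ring. vabs (f t)) \<le> (SUP n. vabs (\<psi> n))"
    using int_ring_0 by (intro cSUP_least) (auto simp: bounded_by_def)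
  ultimately show ?thesis by (simp add: sup_norm_def)
qed

text \<open>Partial sums of any expansion are linear polynomials tending to \<open>f\<close>, so
  their coordinates must converge to the \<open>\<psi> k\<close>.\<close>

lemma expansion_unique:
  assumes "expansion (\<lambda>n. ev (Q n)) c f"
  shows "c = \<psi>"
proof
  fix k
  define F where "F N = (\<Sum>n<N. Polynomial.smult (c n) (Q n))" for N
  have "lin_approx q \<iota> F f"
    using assms by (simp add: lin_approx_def F_def lin_sum lin_smult lin_Q poly_sum expansion_def)
  then have "(\<lambda>N. coord k (F N)) \<longlonglongrightarrow> \<psi> k" using \<psi> unfolding delta_value_def by blast
  \<comment> \<open>Coordinate \<open>k\<close> of the partial sums is constant once index
    \<open>k\<close> is included, that is from \<open>Suc k\<close> on.\<close>
  moreover have "eventually (\<lambda>N. coord k (F N) = c k) sequentially"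
    unfolding eventually_sequentially F_def coord_sum_Q by (intro exI[of _ "Suc k"]) auto
  then have "(\<lambda>N. coord k (F N)) \<longlonglongrightarrow> c k" by (rule tendsto_eventually)
  ultimately show "c k = \<psi> k" by (rule LIMSEQ_unique[symmetric])
qed

end

lemma delta_values_exist:
  assumes "f \<in> C0 \<iota>"
  shows "\<exists>\<psi>. \<forall>n. delta_value q \<iota> \<delta> n f (\<psi> n)"
  by (intro choice allI delta_value_exists assms)

lemma orthonormal_basis_Q: "orthonormal_basis \<iota> (\<lambda>n. ev (Q n))"
  unfolding orthonormal_basis_def
proof (intro conjI allI ballI)
  show "ev (Q n) \<in> C0 \<iota>" for n by (intro ev_C0 lin_Q)
  fix f assume f: "f \<in> C0 \<iota>"
  obtain \<psi> where \<psi>: "\<And>n. delta_value q \<iota> \<delta> n f (\<psi> n)" using delta_values_exist[OF f] by blast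
  have "\<psi> \<longlonglongrightarrow> 0" using coefficients_tendsto_0[OF f \<psi>] by (subst tendsto_vabs_iff) simp
  then show "\<exists>c. c \<longlonglongrightarrow> 0 \<and> expansion (\<lambda>n. ev (Q n)) c f \<and> sup_norm f = (SUP n. vabs (c n)) \<and>
      (\<forall>c'. c' \<longlonglongrightarrow> 0 \<and> expansion (\<lambda>n. ev (Q n)) c' f \<longrightarrow> c' = c)"
    using expansion[OF f \<psi>] sup_norm_eq[OF f \<psi>] expansion_unique[OF f \<psi>] by blast
qed

end

theorem theorem2:
  fixes p \<nu> q :: nat
    and \<iota> :: "'k::{field,finite} fls \<Rightarrow> 'c::{field,complete_space}"
    and \<sigma> :: "nat \<Rightarrow> 'c"
    and \<delta>0 \<delta> :: "'c poly \<Rightarrow> 'c poly"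
    and P Q :: "nat \<Rightarrow> 'c poly"
  assumes "Factorial_Ring.prime p" and "q = p ^ \<nu>" and "CARD('k) = q"
    and "completed_alg_closure \<iota>"
    and "vabs (\<sigma> 1) = 1" and "\<And>l. 2 \<le> l \<Longrightarrow> vabs (\<sigma> l) \<le> 1"
    and "\<delta>0 = Delta_series q \<iota> \<sigma>"
    and "\<delta> = tau_inv q \<circ> \<delta>0"
    and "delta_operator q \<iota> \<delta>"
    and "basic_sequence q \<iota> \<delta> P"
    and "\<And>n. Q n = Polynomial.smult (inverse (\<iota> (carlitz_D q n))) (P n)"
  shows "orthonormal_basis \<iota> (\<lambda>n t. poly (Q n) (\<iota> t)) \<and>
         (\<forall>f\<in>C0 \<iota>. \<exists>\<psi>. (\<forall>n. delta_value q \<iota> \<delta> n f (\<psi> n)) \<and>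
            uniform_limit int_ring (\<lambda>N t. \<Sum>n<N. \<psi> n * poly (Q n) (\<iota> t)) f sequentially \<and>
            (\<lambda>n. vabs (\<psi> n)) \<longlonglongrightarrow> 0 \<and>
            sup_norm f = (SUP n. vabs (\<psi> n)))"
proof -
  interpret delta_basis p \<nu> q \<iota> \<sigma> \<delta> P Q
    using assms by unfold_locales simp_all
  have "\<exists>\<psi>. (\<forall>n. delta_value q \<iota> \<delta> n f (\<psi> n)) \<and>
      uniform_limit int_ring (\<lambda>N t. \<Sum>n<N. \<psi> n * poly (Q n) (\<iota> t)) f sequentially \<and>
      (\<lambda>n. vabs (\<psi> n)) \<longlonglongrightarrow> 0 \<and> sup_norm f = (SUP n. vabs (\<psi> n))"
    if f: "f \<in> C0 \<iota>" for f
  proof -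
    obtain \<psi> where \<psi>: "\<And>n. delta_value q \<iota> \<delta> n f (\<psi> n)"
      using delta_values_exist[OF f] by blast
    then show ?thesis
      using expansion[OF f \<psi>, unfolded expansion_def] coefficients_tendsto_0[OF f \<psi>]
        sup_norm_eq[OF f \<psi>] by blast
  qed
  then show ?thesis using orthonormal_basis_Q by blast
qed

end
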